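(* Let $\phi:(0,2\pi]\to(0,\infty)$ be a continuous increasing function such that $\phi(x)/x$ is strictly decreasing and $$\int_0^{2\pi}\frac{\phi(x)}{x}\,dx=\infty.$$ Then there exists a finite positive Borel measure $\mu$ on the open unit disk $\mathbb{D}$ that satisfies $$\mu(S(I))=O(\phi(|I|))\qquad(|I|\to0),$$ where $I$ ranges over arcs of the unit circle, but that is not a Carleson measure for the Dirichlet space $\mathcal{D}$.
   Context: $\mathbb{D}$ denotes the open unit disk in $\mathbb{C}$, and $\mathbb{T}$ the unit circle. For an arc $I\subset\mathbb{T}$, $|I|$ denotes its arclength, and the associated Carleson box is $S(I):=\{re^{i\theta}:1-|I|<r<1,\ e^{i\theta}\in I\}$. The condition $\mu(S(I))=O(\phi(|I|))$ as $|I|\to0$ means that there exist constants $C,\delta>0$ such that $\mu(S(I))\le C\phi(|I|)$ for every arc $I\subset\mathbb{T}$ with $0<|I|<\delta$. The Dirichlet space $\mathcal{D}$ is the space of functions $f$ holomorphic in $\mathbb{D}$ with finite Dirichlet integral $\mathcal{D}(f):=\frac1\pi\int_{\mathbb{D}}|f'(z)|^2\,dA(z)<\infty$ ($dA$ is area Lebesgue measure), normed by $\|f\|_{\mathcal{D}}^2:=|f(0)|^2+\mathcal{D}(f)$. A positive measure $\mu$ on $\mathbb{D}$ is a Carleson measure for $\mathcal{D}$ if there exists a constant $C$ such that $\int_{\mathbb{D}}|f(z)|^2\,d\mu(z)\le C\|f\|_{\mathcal{D}}^2$ for all $f\in\mathcal{D}$. *)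

theory Defs
  imports "HOL-Complex_Analysis.Complex_Analysis"
begin

(* Open, closed and half-open arcs are all included, as is the full circle (J = UNIV);
   degenerate arcs are excluded where needed by requiring positive arclength. *)
definition circle_arc :: "complex set \<Rightarrow> bool" where
  "circle_arc I \<longleftrightarrow> (\<exists>J :: real set. is_interval J \<and> I = cis ` J)"

definition arclength :: "complex set \<Rightarrow> real" where
  "arclength I = measure lborel {t \<in> {0..<2 * pi}. cis t \<in> I}"

(* If arclength I > 1 then negative r occur; this is harmless, as only arcs with
   arclength below an arbitrarily small bound matter in one_box_condition. *)
definition carleson_box :: "complex set \<Rightarrow> complex set" where
  "carleson_box I =
     {of_real r * cis \<theta> | r \<theta>. 1 - arclength I < r \<and> r < 1 \<and> cis \<theta> \<in> I}"

definition one_box_condition :: "complex measure \<Rightarrow> (real \<Rightarrow> real) \<Rightarrow> bool" where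
  "one_box_condition \<mu> \<phi> \<longleftrightarrow>
     (\<exists>C > 0. \<exists>\<delta> > 0. \<forall>I. circle_arc I \<and> 0 < arclength I \<and> arclength I < \<delta> \<longrightarrow>
        measure \<mu> (carleson_box I) \<le> C * \<phi> (arclength I))"

definition finite_borel_measure_on_disk :: "complex measure \<Rightarrow> bool" where
  "finite_borel_measure_on_disk \<mu> \<longleftrightarrow>
     sets \<mu> = sets (restrict_space borel (ball 0 1)) \<and> finite_measure \<mu>"

definition dirichlet_integral :: "(complex \<Rightarrow> complex) \<Rightarrow> ennreal" where
  "dirichlet_integral f =
     ennreal (1 / pi) * (\<integral>\<^sup>+ z \<in> ball 0 1. ennreal ((cmod (deriv f z))\<^sup>2) \<partial>lborel)"

definition dirichlet_space :: "(complex \<Rightarrow> complex) set" where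
  "dirichlet_space = {f. f holomorphic_on ball 0 1 \<and> dirichlet_integral f < \<infinity>}"

definition dirichlet_norm :: "(complex \<Rightarrow> complex) \<Rightarrow> real" where
  "dirichlet_norm f = sqrt ((cmod (f 0))\<^sup>2 + enn2real (dirichlet_integral f))"

definition dirichlet_carleson_measure :: "complex measure \<Rightarrow> bool" where
  "dirichlet_carleson_measure \<mu> \<longleftrightarrow>
     (\<exists>C \<ge> 0. \<forall>f \<in> dirichlet_space.
        (\<integral>\<^sup>+ z. ennreal ((cmod (f z))\<^sup>2) \<partial>\<mu>) \<le> ennreal (C * (dirichlet_norm f)\<^sup>2))"

end

theory Submission
  imports Defs "HOL-Probability.Probability"
begin

text \<open>
  The obstruction comes from energy. For a positive measure \<open>\<nu>\<close> on the disk with moments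
  \<open>c k = \<integral> w ^ k d\<nu>\<close>, the polynomial \<open>f z = \<Sum>k=1..n. cnj (c k) / k * z ^ k\<close> has Dirichlet integral
  \<open>E = \<Sum>k=1..n. \<bar>c k\<bar>\<^sup>2 / k\<close>, which is also the value of \<open>\<integral> f d\<nu>\<close>. If \<open>\<nu>\<close> is a probability measure,
  the Cauchy-Schwarz inequality gives \<open>\<integral> \<bar>f\<bar>\<^sup>2 d\<nu> \<ge> E\<^sup>2\<close>, so a Carleson constant of \<open>\<nu>\<close> is at least
  \<open>E\<close> (lemma \<open>energy_test_function\<close>). It therefore suffices to find measures that satisfy the box
  condition with one common constant and have arbitrarily large energy.

  Such measures live on finite stages of a Cantor set. Choose a set \<open>A\<close> of binary digit positions
  and let the points of stage \<open>K\<close> have angles \<open>2 * pi * x\<close>, where the digits of \<open>x\<close> at the positions of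
  \<open>A\<close> up to \<open>K\<close> are free and the others vanish; give all points equal mass. With \<open>N m\<close> the number of
  positions in \<open>A\<close> up to \<open>m\<close>, an arc of length comparable to \<open>2 ^ -m\<close>, \<open>m \<le> K\<close>, has mass at most a constant
  times \<open>2 ^ -N m\<close>. Because \<open>\<phi> x / x\<close> decreases, halving \<open>x\<close> at most halves \<open>\<phi>\<close>, so \<open>A\<close> can be
  chosen such that \<open>2 ^ -N m\<close> is comparable to \<open>\<phi> (2 ^ -m)\<close> (lemma \<open>gauge_digits\<close>). Arcs shorter
  than \<open>2 ^ -K\<close> are no concern: the points are placed on the circle of radius \<open>1 - 2 ^ -K\<close>, outside
  their boxes. Hence the box condition holds uniformly in \<open>K\<close>.

  The moments of the stage-\<open>K\<close> measure on the unit circle satisfy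
  \<open>\<bar>c k\<bar>\<^sup>2 = (\<Prod>i. cos\<^sup>2 (pi * k / 2 ^ i))\<close>, the product running over the positions \<open>i \<le> K\<close> in \<open>A\<close>.
  The partial product over \<open>i \<le> m\<close> is periodic in \<open>k\<close> with mean \<open>2 ^ -N m\<close>, and for \<open>k \<le> 2 ^ (m - 1)\<close> the
  remaining factors stay away from 0. A dyadic summation then bounds the energy from below by a
  multiple of \<open>\<Sum>m\<le>K. 2 ^ -N m\<close> up to an additive constant (lemma \<open>riesz_energy_ge\<close>). This sum is
  comparable to \<open>\<Sum>m\<le>K. \<phi> (2 ^ -m)\<close>, a discretisation of the divergent integral of \<open>\<phi> x / x\<close>.

  Finally a single measure is obtained by mixing the stages \<open>\<kappa> n\<close> with weights \<open>2 ^ -(n + 1)\<close>, where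
  \<open>\<kappa> n\<close> is chosen so that the energy of that stage is at least \<open>4 ^ n\<close>: the energies outgrow the
  weights, while the box condition passes to convex combinations.
\<close>

section \<open>The Dirichlet integral of a polynomial\<close>

text \<open>
  The orthogonal invariance of Lebesgue measure on the coordinate plane passes to the complex plane
  through this isometry.
\<close>
definition complex_of_vec :: "real^2 \<Rightarrow> complex" where "complex_of_vec v = Complex (v$1) (v$2)"

lemma complex_of_vec_measurable [measurable]: "complex_of_vec \<in> borel_measurable borel"
proof -
  have "continuous_on UNIV complex_of_vec"
    unfolding complex_of_vec_def Complex_eq by (intro continuous_intros)
  thus ?thesis by (rule borel_measurable_continuous_onI)
qed

lemma lborel_complex_eq: "(lborel :: complex measure) = distr lborel borel complex_of_vec"
proof (rule lborel_eqI)
  fix l u :: complex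
  assume le: "\<And>b. b \<in> Basis \<Longrightarrow> l \<bullet> b \<le> u \<bullet> b"
  have le': "Re l \<le> Re u" "Im l \<le> Im u"
    using le[of 1] le[of \<i>] by (auto simp: Basis_complex_def)
  define l' u' :: "real^2" where "l' = vector [Re l, Im l]" and "u' = vector [Re u, Im u]"
  have "complex_of_vec -` box l u = box l' u'"
    by (auto simp: complex_of_vec_def box_def Basis_complex_def Basis_vec_def inner_axis l'_def u'_def forall_2 exhaust_2)
  moreover have "\<forall>b\<in>Basis. l' \<bullet> b \<le> u' \<bullet> b"
    using le' by (auto simp: Basis_vec_def inner_axis l'_def u'_def forall_2)
  ultimately have "emeasure (distr lborel borel complex_of_vec) (box l u) = ennreal (\<Prod>b\<in>Basis. (u' - l') \<bullet> b)"
    by (simp add: emeasure_distr emeasure_lborel_box_eq)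
  also have "(\<Prod>b\<in>Basis. (u' - l') \<bullet> b) = (Re u - Re l) * (Im u - Im l)"
  proof -
    have "(\<Prod>b\<in>(Basis::(real^2) set). (u' - l') \<bullet> b) = (\<Prod>i\<in>UNIV. (u' - l') $ i)"
    proof -
      have "Basis = range (\<lambda>i. axis i (1::real) :: real^2)"
        by (auto simp: Basis_vec_def)
      hence "(\<Prod>b\<in>(Basis::(real^2) set). (u' - l') \<bullet> b)
          = (\<Prod>b\<in>range (\<lambda>i. axis i (1::real) :: real^2). (u' - l') \<bullet> b)"
        by simp
      also have "\<dots> = (\<Prod>i\<in>UNIV. (u' - l') \<bullet> axis i 1)"
        by (subst prod.reindex) (auto simp: inj_def axis_eq_axis)
      finally show ?thesis by (simp add: inner_axis)
    qed
    thus ?thesis by (simp add: UNIV_2 l'_def u'_def)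
  qed
  also have "\<dots> = (\<Prod>b\<in>Basis. (u - l) \<bullet> b)"
    by (simp add: Basis_complex_def)
  finally show "emeasure (distr lborel borel complex_of_vec) (box l u) = ennreal (\<Prod>b\<in>Basis. (u - l) \<bullet> b)" .
qed simp

lemma emeasure_lborel_complex:
  assumes "S \<in> sets borel"
  shows "emeasure (lborel :: complex measure) S = emeasure lborel (complex_of_vec -` S)"
  by (subst lborel_complex_eq) (use assms in \<open>simp add: emeasure_distr\<close>)

text \<open>
  It is enough to compare both measures on boxes, and the preimage of a box under multiplication by
  \<open>c\<close> is its image under the inverse rotation, which is an orthogonal map of the plane.
\<close>
lemma lborel_distr_rotation:
  assumes "cmod c = 1"
  shows "distr lborel borel ((*) c) = (lborel :: complex measure)"
proof (rule lborel_eqI[symmetric])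
  fix l u :: complex
  assume le: "\<And>b. b \<in> Basis \<Longrightarrow> l \<bullet> b \<le> u \<bullet> b"
  have cc: "c * cnj c = 1" using assms by (simp add: complex_norm_square [symmetric])
  define R :: "real^2 \<Rightarrow> real^2" where 
    "R v = vector [Re (cnj c * complex_of_vec v), Im (cnj c * complex_of_vec v)]" for v
  have cR: "complex_of_vec (R v) = cnj c * complex_of_vec v" for v
    by (simp add: R_def complex_of_vec_def complex_eq_iff)
  have inj: "complex_of_vec v = complex_of_vec w \<longleftrightarrow> v = w" for v w
    by (auto simp: complex_of_vec_def vec_eq_iff forall_2)
  have "linear R"
    by (rule linearI) (auto simp: R_def vec_eq_iff forall_2 complex_of_vec_def algebra_simps)
  moreover have "norm (R v) = norm v" for v
  proof -
    have n: "norm w = cmod (complex_of_vec w)" for w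
      by (simp add: norm_vec_def L2_set_def UNIV_2 complex_of_vec_def cmod_def)
    show ?thesis by (simp add: n cR norm_mult assms)
  qed
  ultimately have orth: "orthogonal_transformation R"
    by (simp add: orthogonal_transformation)
  have box: "((*) c) -` box l u \<in> sets borel" 
    by (intro borel_open open_vimage continuous_intros) auto
  have boxl: "complex_of_vec -` box l u \<in> sets borel"
    using measurable_sets[OF complex_of_vec_measurable, of "box l u"] by simp
  have img: "complex_of_vec -` (((*) c) -` box l u) = R ` (complex_of_vec -` box l u)" (is "?L = R ` ?B")
  proof (intro set_eqI iffI)
    fix v assume v: "v \<in> ?L"
    define w :: "real^2" where "w = vector [Re (c * complex_of_vec v), Im (c * complex_of_vec v)]"
    have w: "complex_of_vec w = c * complex_of_vec v" by (simp add: w_def complex_of_vec_def complex_eq_iff)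
    have "complex_of_vec (R w) = complex_of_vec v" using cc by (simp add: cR w mult_ac)
    hence "v = R w" using inj by simp
    moreover have "w \<in> ?B" using v w by simp
    ultimately show "v \<in> R ` ?B" by blast
  next
    fix v assume "v \<in> R ` ?B"
    then obtain w where "v = R w" "complex_of_vec w \<in> box l u" by auto
    thus "v \<in> ?L" by (simp add: cR cc flip: mult.assoc)
  qed
  have fin: "emeasure lborel ?B < \<infinity>"
    using emeasure_lborel_complex[of "box l u"] emeasure_bounded_finite[of "box l u"] by simp
  have lm: "?B \<in> lmeasurable"
    using boxl fin by (intro fmeasurableI) auto
  have "emeasure lborel (((*) c) -` box l u) = emeasure lborel (R ` ?B)"
    using emeasure_lborel_complex[OF box] img by simp
  also have "\<dots> = emeasure lebesgue (R ` ?B)"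
  proof -
    have "R ` ?B \<in> sets borel"
      using measurable_sets[OF complex_of_vec_measurable box] img by simp
    thus ?thesis by simp
  qed
  also have "\<dots> = emeasure lebesgue ?B"
    using measure_orthogonal_image[OF orth lm] measurable_orthogonal_image[OF orth lm] lm
    by (simp add: emeasure_eq_measure2)
  also have "\<dots> = emeasure lborel (box l u)"
    using boxl emeasure_lborel_complex[of "box l u"] by simp
  also have "\<dots> = ennreal (\<Prod>b\<in>Basis. (u - l) \<bullet> b)"
    using le by (rule emeasure_lborel_box)
  finally show "emeasure (distr lborel borel ((*) c)) (box l u) = ennreal (\<Prod>b\<in>Basis. (u - l) \<bullet> b)"
    by (simp add: emeasure_distr)
qed simp

lemma nn_integral_rotation:
  fixes g :: "complex \<Rightarrow> ennreal"
  assumes c: "cmod c = 1" and [measurable]: "g \<in> borel_measurable borel"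
  shows "(\<integral>\<^sup>+z. g (c * z) \<partial>lborel) = (\<integral>\<^sup>+z. g z \<partial>lborel)"
  by (subst (2) lborel_distr_rotation[OF c, symmetric]) (simp add: nn_integral_distr)

text \<open>
  Polar coordinates are avoided by a scaling argument. If \<open>j\<close> is the integral, the disk of radius \<open>r\<close>
  contributes \<open>r ^ (2 * m + 2) * j\<close> to it, and the remaining annulus at most its area \<open>pi * (1 - r\<^sup>2)\<close>. Dividing
  by \<open>1 - r\<^sup>2\<close> and letting \<open>r\<close> tend to 1 yields the bound, which is in fact an equality.
\<close>
lemma disk_moment_le:
  "(\<integral>\<^sup>+z\<in>ball 0 1. ennreal (cmod z ^ (2 * m)) \<partial>lborel) \<le> ennreal (pi / (m + 1))"
proof -
  define J where "J r = (\<integral>\<^sup>+z\<in>ball 0 r. ennreal (cmod z ^ (2 * m)) \<partial>lborel)" for r :: real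
  have meas: "(\<lambda>z::complex. ennreal (cmod z ^ (2 * m)) * indicator (ball 0 r) z) \<in> borel_measurable borel" for r
    by (intro borel_measurable_times_ennreal borel_measurable_indicator) auto
  have ball: "emeasure lborel (ball (0::complex) r) = ennreal (pi * r\<^sup>2)" if "r \<ge> 0" for r
    using emeasure_ball[OF that, of "0::complex"] by (simp add: unit_ball_vol_2)
  have scal: "J r = ennreal (r ^ (2 * m + 2)) * J 1" if r: "0 < r" for r
  proof -
    have "J r = (\<integral>\<^sup>+z. ennreal (r^2) * (ennreal (cmod (r *\<^sub>R z) ^ (2 * m)) * indicator (ball 0 r) (r *\<^sub>R z)) \<partial>lborel)"
      unfolding J_def 
      by (subst lborel_affine[of r 0])
         (use r meas in \<open>simp_all add: nn_integral_density nn_integral_distr del: norm_scaleR\<close>)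
    also have "\<dots> = (\<integral>\<^sup>+z. ennreal (r ^ (2 * m + 2)) * (ennreal (cmod z ^ (2 * m)) * indicator (ball 0 1) z) \<partial>lborel)"
      using r by (intro nn_integral_cong)
        (auto simp: power_mult_distrib power_add ennreal_mult' mult_ac power2_eq_square split: split_indicator)
    finally show ?thesis
      unfolding J_def
      using meas by (subst (asm) nn_integral_cmult) auto
  qed
  have le1: "cmod z ^ (2 * m) \<le> 1" if "z \<in> ball 0 1" for z
    using that by (simp add: power_le_one)
  have "J 1 \<le> (\<integral>\<^sup>+z. indicator (ball 0 1) (z::complex) \<partial>lborel)"
    unfolding J_def by (intro nn_integral_mono) (use le1 in \<open>auto split: split_indicator\<close>)
  also have "\<dots> = ennreal pi" using ball[of 1] by simp
  finally obtain j where j: "J 1 = ennreal j" "j \<ge> 0"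
    by (metis ennreal_cases ennreal_less_top infinity_ennreal_def linorder_not_less top.not_eq_extremum)
  have key: "j * (\<Sum>i<Suc m. s ^ i) \<le> pi" if s: "0 < s" "s < 1" for s
  proof -
    \<comment> \<open>the ratio of the areas of the inner disk and the unit disk is \<open>s\<close>\<close>
    define r where "r = sqrt s"
    have r: "0 < r" "r < 1" "r^2 = s" using s by (auto simp: r_def)
    have "J 1 \<le> (\<integral>\<^sup>+z. ennreal (cmod z ^ (2 * m)) * indicator (ball 0 r) z
                      + indicator (ball 0 1 - ball 0 r) z \<partial>lborel)"
      unfolding J_def by (intro nn_integral_mono) (use le1 in \<open>auto split: split_indicator\<close>)
    also have "\<dots> = J r + emeasure lborel (ball (0::complex) 1 - ball 0 r)"
      unfolding J_def using meas by (subst nn_integral_add) (auto intro: borel_measurable_indicator)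
    also have "emeasure lborel (ball (0::complex) 1 - ball 0 r) = ennreal (pi * 1^2) - ennreal (pi * r^2)"
      using r ball[of 1] ball[of r] by (subst emeasure_Diff) auto
    also have "\<dots> = ennreal (pi - pi * s)"
      using r s by (subst ennreal_minus) auto
    also have "J r = ennreal (s ^ Suc m * j)"
    proof -
      have "r ^ (2 * m + 2) = (r^2) ^ Suc m"
        by (simp only: power_mult[symmetric]) (simp add: algebra_simps)
      thus ?thesis using scal[OF r(1)] r(3) s j by (simp add: ennreal_mult')
    qed
    finally have le: "ennreal j \<le> ennreal (s ^ Suc m * j + (pi - pi * s))"
      using s j by (simp add: ennreal_plus)
    have "j * (1 - s ^ Suc m) \<le> pi * (1 - s)"
    proof -
      have "pi * s \<le> pi * 1" using s by (intro mult_left_mono) auto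
      hence "0 \<le> s ^ Suc m * j + (pi - pi * s)" using s j by simp
      with le show ?thesis by (simp add: ennreal_le_iff algebra_simps)
    qed
    also have "1 - s ^ Suc m = (1 - s) * (\<Sum>i<Suc m. s ^ i)"
      by (rule one_diff_power_eq)
    finally have "(1 - s) * (j * (\<Sum>i<Suc m. s ^ i)) \<le> (1 - s) * pi"
      by (simp add: mult_ac)
    thus ?thesis using s by (simp only: mult_le_cancel_left_pos)
  qed
  have "((\<lambda>s. j * (\<Sum>i<Suc m. s ^ i)) \<longlongrightarrow> j * (\<Sum>i<Suc m. 1 ^ i)) (at_left (1::real))"
    by (intro tendsto_intros)
  moreover have "\<forall>\<^sub>F s in at_left (1::real). j * (\<Sum>i<Suc m. s ^ i) \<le> pi"
    using eventually_at_left_real[of 0 "1::real"] by (rule eventually_mono) (use key in auto)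
  ultimately have "j * (\<Sum>i<Suc m. 1 ^ i) \<le> pi"
    by (intro tendsto_upperbound) auto
  hence "j \<le> pi / (m + 1)" by (simp add: field_simps)
  thus ?thesis using j unfolding J_def by (simp add: ennreal_leI)
qed

text \<open>
  Expanding the squares leaves sums of powers of \<open>\<omega> ^ (k - l)\<close>, which vanish for \<open>k \<noteq> l\<close> since that
  number is a nontrivial \<open>n\<close>-th root of unity.
\<close>
lemma discrete_parseval:
  fixes d :: "nat \<Rightarrow> complex"
  assumes n: "n > 0"
  defines "\<omega> \<equiv> cis (2 * pi / n)"
  shows "(\<Sum>j<n. (cmod (\<Sum>k<n. d k * (\<omega> ^ j) ^ k))\<^sup>2) = n * (\<Sum>k<n. (cmod (d k))\<^sup>2)"
proof -
  have root: "(\<Sum>j<n. (\<omega> ^ j) ^ k * cnj ((\<omega> ^ j) ^ l)) = (if k = l then of_nat n else 0)"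
    if kl: "k < n" "l < n" for k l
  proof -
    define q where "q = \<omega> ^ k * cnj \<omega> ^ l"
    have \<omega>c: "\<omega> * cnj \<omega> = 1" by (simp add: \<omega>_def cis_cnj cis_mult)
    have "(\<Sum>j<n. (\<omega> ^ j) ^ k * cnj ((\<omega> ^ j) ^ l)) = (\<Sum>j<n. q ^ j)"
      by (simp add: q_def power_mult_distrib flip: power_mult) (simp add: mult.commute)
    also have "\<dots> = (if k = l then of_nat n else 0)"
    proof (cases "k = l")
      case True
      thus ?thesis by (simp add: q_def \<omega>c flip: power_mult_distrib)
    next
      case False
      have qc: "q = cis (2 * pi * (real k - real l) / n)"
        by (simp add: q_def \<omega>_def Complex.DeMoivre cis_cnj cis_mult diff_divide_distrib algebra_simps)
      have "q \<noteq> 1"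
      proof
        assume "q = 1"
        hence "cos (2 * pi * (real k - real l) / n) = 1"
          unfolding qc by (simp add: complex_eq_iff)
        then obtain x :: int where "2 * pi * (real k - real l) / n = x * (2 * pi)"
          by (auto simp: cos_one_2pi_int)
        hence "2 * pi * (real k - real l) = 2 * pi * (x * real n)" using n by (simp add: field_simps)
        hence "real k - real l = x * real n" by simp
        hence eq: "int k - int l = x * int n"
          by (metis of_int_diff of_int_eq_iff of_int_mult of_int_of_nat_eq)
        have "\<bar>x * int n\<bar> < int n" using kl unfolding eq[symmetric] by auto
        hence "x = 0" using n by (simp add: abs_mult)
        thus False using eq False by simp
      qed
      moreover have "q ^ n = 1"
      proof -
        have "\<omega> ^ n = 1" using n by (simp add: \<omega>_def Complex.DeMoivre)
        thus ?thesis unfolding q_def power_mult_distrib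
          by (metis complex_cnj_one complex_cnj_power mult.commute mult_1 power_mult power_one)
      qed
      ultimately show ?thesis using False by (simp add: sum_gp_strict)
    qed
    finally show ?thesis .
  qed
  have "complex_of_real (\<Sum>j<n. (cmod (\<Sum>k<n. d k * (\<omega> ^ j) ^ k))\<^sup>2)
      = (\<Sum>j<n. \<Sum>k<n. \<Sum>l<n. d k * cnj (d l) * ((\<omega> ^ j) ^ k * cnj ((\<omega> ^ j) ^ l)))"
    unfolding of_real_sum complex_norm_square cnj_sum sum_product
    by (intro sum.cong refl) (simp add: mult_ac)
  also have "\<dots> = (\<Sum>k<n. \<Sum>l<n. d k * cnj (d l) * (\<Sum>j<n. (\<omega> ^ j) ^ k * cnj ((\<omega> ^ j) ^ l)))"
    by (simp only: sum_distrib_left) (subst sum.swap, rule sum.cong[OF refl], rule sum.swap)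
  also have "\<dots> = (\<Sum>k<n. \<Sum>l<n. if k = l then of_nat n * (d k * cnj (d k)) else 0)"
    by (intro sum.cong refl, subst root) auto
  also have "\<dots> = complex_of_real (n * (\<Sum>k<n. (cmod (d k))\<^sup>2))"
    by (simp add: sum_distrib_left complex_norm_square del: of_real_power)
  finally show ?thesis by (simp only: of_real_eq_iff)
qed

text \<open>
  The monomials are orthogonal on the disk. Since there are finitely many of them, averaging over
  the \<open>n\<close> rotations by roots of unity already removes all mixed terms.
\<close>
lemma disk_integral_polynomial_le:
  fixes b :: "nat \<Rightarrow> complex"
  shows "(\<integral>\<^sup>+z\<in>ball 0 1. ennreal ((cmod (\<Sum>k<n. b k * z ^ k))\<^sup>2) \<partial>lborel)
           \<le> ennreal (pi * (\<Sum>k<n. (cmod (b k))\<^sup>2 / (k + 1)))"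
proof (cases "n = 0")
  case False
  define \<omega> where "\<omega> = cis (2 * pi / n)"
  define g where "g z = ennreal ((cmod (\<Sum>k<n. b k * z ^ k))\<^sup>2) * indicator (ball 0 1) z" for z
  have [measurable]: "g \<in> borel_measurable borel"
    unfolding g_def by (intro borel_measurable_times_ennreal borel_measurable_indicator) auto
  have \<omega>1: "cmod (\<omega> ^ j) = 1" for j by (simp add: \<omega>_def norm_power)
  have pars: "(\<Sum>j<n. g (\<omega> ^ j * z))
      = (\<Sum>k<n. ennreal (n * (cmod (b k))\<^sup>2) * (ennreal (cmod z ^ (2 * k)) * indicator (ball 0 1) z))" for z
  proof -
    have "(\<Sum>j<n. g (\<omega> ^ j * z)) = (\<Sum>j<n. ennreal ((cmod (\<Sum>k<n. (b k * z ^ k) * (\<omega> ^ j) ^ k))\<^sup>2)) * indicator (ball 0 1) z"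
      unfolding g_def sum_distrib_right
      by (intro sum.cong refl) (simp add: norm_mult \<omega>1 power_mult_distrib mult_ac split: split_indicator)
    also have "(\<Sum>j<n. ennreal ((cmod (\<Sum>k<n. (b k * z ^ k) * (\<omega> ^ j) ^ k))\<^sup>2))
        = ennreal (n * (\<Sum>k<n. (cmod (b k * z ^ k))\<^sup>2))"
      using discrete_parseval[of n "\<lambda>k. b k * z ^ k"] False
      by (subst sum_ennreal) (auto simp: \<omega>_def)
    also have "\<dots> = (\<Sum>k<n. ennreal (n * (cmod (b k))\<^sup>2 * cmod z ^ (2 * k)))"
      by (subst sum_ennreal) (auto simp: sum_distrib_left norm_mult norm_power power_mult_distrib
            mult_ac simp flip: power_mult)
    finally show ?thesis
      by (simp add: sum_distrib_left sum_distrib_right ennreal_mult' mult_ac)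
  qed
  have "of_nat n * (\<integral>\<^sup>+z. g z \<partial>lborel) = (\<Sum>j<n. \<integral>\<^sup>+z. g (\<omega> ^ j * z) \<partial>lborel)"
    by (simp add: nn_integral_rotation[OF \<omega>1])
  also have "\<dots> = (\<integral>\<^sup>+z. (\<Sum>j<n. g (\<omega> ^ j * z)) \<partial>lborel)"
    by (rule nn_integral_sum[symmetric]) measurable
  also have "\<dots> = (\<Sum>k<n. ennreal (n * (cmod (b k))\<^sup>2) * (\<integral>\<^sup>+z\<in>ball 0 1. ennreal (cmod z ^ (2 * k)) \<partial>lborel))"
    unfolding pars
    by (subst nn_integral_sum, (subst nn_integral_cmult)?)
       (auto intro!: borel_measurable_times_ennreal borel_measurable_indicator sum.cong nn_integral_cmult)
  also have "\<dots> \<le> (\<Sum>k<n. ennreal (n * (cmod (b k))\<^sup>2) * ennreal (pi / (k + 1)))"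
    by (intro sum_mono mult_left_mono disk_moment_le) auto
  also have "\<dots> = ennreal (n * (pi * (\<Sum>k<n. (cmod (b k))\<^sup>2 / (k + 1))))"
    by (subst sum_ennreal [symmetric] | simp add: sum_distrib_left ennreal_mult'[symmetric] mult_ac)+
  also have "\<dots> = of_nat n * ennreal (pi * (\<Sum>k<n. (cmod (b k))\<^sup>2 / (k + 1)))"
    by (simp add: ennreal_mult' ennreal_of_nat_eq_real_of_nat)
  finally have "of_nat n * (\<integral>\<^sup>+z. g z \<partial>lborel) \<le> of_nat n * ennreal (pi * (\<Sum>k<n. (cmod (b k))\<^sup>2 / (k + 1)))" .
  thus ?thesis using False unfolding g_def
    by (subst (asm) ennreal_mult_le_mult_iff) (auto simp: of_nat_eq_0_iff)
qed auto

section \<open>Testing the Carleson inequality by energy\<close>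

text \<open>
  The test function is the truncated potential of the uniform measure on the points \<open>w i\<close>: its mean
  over these points equals its Dirichlet integral \<open>E\<close>. The inequality \<open>E\<^sup>2 \<le> mean of \<bar>f\<bar>\<^sup>2\<close> follows from the
  nonnegativity of \<open>\<bar>f - E\<bar>\<^sup>2\<close>.
\<close>
lemma energy_test_function:
  fixes w :: "'i \<Rightarrow> complex" and n :: nat
  assumes I: "finite I" "I \<noteq> {}"
  defines "c \<equiv> \<lambda>k. (\<Sum>i\<in>I. w i ^ k) / of_nat (card I)"
  defines "E \<equiv> \<Sum>k\<in>{1..n}. (cmod (c k))\<^sup>2 / real k"
  shows "\<exists>f\<in>dirichlet_space. (dirichlet_norm f)\<^sup>2 \<le> E \<and> E\<^sup>2 \<le> (\<Sum>i\<in>I. (cmod (f (w i)))\<^sup>2) / real (card I)"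
proof -
  define f where "f z = (\<Sum>k\<in>{1..n}. cnj (c k) / of_nat k * z ^ k)" for z
  have N: "real (card I) > 0" using I by (simp add: card_gt_0_iff)
  have E0: "E \<ge> 0" unfolding E_def by (intro sum_nonneg) auto
  have hol: "f holomorphic_on ball 0 1"
    unfolding f_def by (intro holomorphic_intros)
  have der: "deriv f z = (\<Sum>k<n. cnj (c (Suc k)) * z ^ k)" for z
  proof (rule DERIV_imp_deriv)
    have "(f has_field_derivative (\<Sum>k\<in>{1..n}. cnj (c k) / of_nat k * (of_nat k * z ^ (k - 1)))) (at z)"
      unfolding f_def by (auto intro!: derivative_eq_intros sum.cong)
    also have "(\<Sum>k\<in>{1..n}. cnj (c k) / of_nat k * (of_nat k * z ^ (k - 1))) = (\<Sum>k<n. cnj (c (Suc k)) * z ^ k)"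
      by (rule sum.reindex_bij_witness[of _ Suc "\<lambda>k. k - 1"]) auto
    finally show "(f has_field_derivative (\<Sum>k<n. cnj (c (Suc k)) * z ^ k)) (at z)" .
  qed
  have "dirichlet_integral f \<le> ennreal (1 / pi) * ennreal (pi * (\<Sum>k<n. (cmod (cnj (c (Suc k))))\<^sup>2 / (k + 1)))"
    unfolding dirichlet_integral_def der by (intro mult_left_mono disk_integral_polynomial_le) auto
  also have "\<dots> = ennreal (\<Sum>k<n. (cmod (c (Suc k)))\<^sup>2 / (k + 1))"
    by (subst ennreal_mult'[symmetric]) auto
  also have "(\<Sum>k<n. (cmod (c (Suc k)))\<^sup>2 / (k + 1)) = E"
    unfolding E_def by (rule sum.reindex_bij_witness[of _ "\<lambda>k. k - 1" Suc]) auto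
  finally have D: "dirichlet_integral f \<le> ennreal E" .
  have "f 0 = 0" by (simp add: f_def)
  hence nrm: "(dirichlet_norm f)\<^sup>2 \<le> E"
    using enn2real_mono[OF D] E0 by (simp add: dirichlet_norm_def)
  have memb: "f \<in> dirichlet_space"
    using hol D by (auto simp: dirichlet_space_def intro: le_less_trans)
  have "(\<Sum>i\<in>I. f (w i)) = (\<Sum>k\<in>{1..n}. cnj (c k) / of_nat k * (\<Sum>i\<in>I. w i ^ k))"
    unfolding f_def by (subst sum.swap) (simp add: sum_distrib_left)
  also have "\<dots> = (\<Sum>k\<in>{1..n}. of_nat (card I) * complex_of_real ((cmod (c k))\<^sup>2 / real k))"
  proof (intro sum.cong refl)
    fix k
    have "(\<Sum>i\<in>I. w i ^ k) = of_nat (card I) * c k" using N by (simp add: c_def)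
    thus "cnj (c k) / of_nat k * (\<Sum>i\<in>I. w i ^ k) = of_nat (card I) * complex_of_real ((cmod (c k))\<^sup>2 / real k)"
      by (simp add: complex_norm_square mult_ac del: of_real_power)
  qed
  also have "\<dots> = complex_of_real (real (card I) * E)"
    by (simp add: E_def sum_distrib_left)
  finally have mean: "(\<Sum>i\<in>I. Re (f (w i))) = real (card I) * E"
    by (metis Re_complex_of_real Re_sum)
  have "real (card I) * E\<^sup>2 = (\<Sum>i\<in>I. 2 * E * Re (f (w i)) - E\<^sup>2)"
    unfolding sum_subtractf sum_distrib_left[symmetric] mean by (simp add: power2_eq_square)
  also have "\<dots> \<le> (\<Sum>i\<in>I. (cmod (f (w i)))\<^sup>2)"
  proof (rule sum_mono)
    fix i
    have "0 \<le> (Re (f (w i)) - E)\<^sup>2 + (Im (f (w i)))\<^sup>2" by simp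
    also have "\<dots> = (cmod (f (w i)))\<^sup>2 - (2 * E * Re (f (w i)) - E\<^sup>2)"
      by (simp add: cmod_power2 power2_diff)
    finally show "2 * E * Re (f (w i)) - E\<^sup>2 \<le> (cmod (f (w i)))\<^sup>2" by simp
  qed
  finally have "E\<^sup>2 \<le> (\<Sum>i\<in>I. (cmod (f (w i)))\<^sup>2) / real (card I)"
    using N by (simp add: field_simps)
  with memb nrm show ?thesis by blast
qed

section \<open>Riesz products and the energy of a Cantor stage\<close>

text \<open>
  A set \<open>S\<close> of positive integers is read as the set of positions of the digit 1 in a binary expansion,
  that is, as a fraction of the full turn.
\<close>
definition digit_angle :: "nat set \<Rightarrow> real" where
  "digit_angle S = 2 * pi * (\<Sum>i\<in>S. (1 / 2) ^ i)"

text \<open>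
  By \<open>norm_moment_digit_angle\<close> below, this is the squared modulus of the \<open>k\<close>-th Fourier coefficient of
  the uniform measure on the angles whose binary digits are free at the positions in \<open>D\<close>.
\<close>
definition riesz_product :: "nat set \<Rightarrow> nat \<Rightarrow> real" where
  "riesz_product D k = (\<Prod>i\<in>D. (cos (pi * real k / 2 ^ i))\<^sup>2)"

lemma riesz_product_nonneg: "riesz_product D k \<ge> 0"
  by (simp add: riesz_product_def prod_nonneg)

lemma riesz_product_0 [simp]: "riesz_product D 0 = 1"
  by (simp add: riesz_product_def)

lemma norm_one_plus_cis: "(cmod (1 + cis t))\<^sup>2 = 4 * (cos (t / 2))\<^sup>2"
proof -
  have "(cmod (1 + cis t))\<^sup>2 = 2 + 2 * cos t"
    using sin_cos_squared_add[of t] by (simp add: cmod_power2 power2_sum)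
  also have "cos t = 2 * (cos (t / 2))\<^sup>2 - 1"
    using cos_double_cos[of "t / 2"] by simp
  finally show ?thesis by simp
qed

lemma cis_sum_eq_prod:
  assumes "finite S"
  shows "cis (\<Sum>i\<in>S. f i) = (\<Prod>i\<in>S. cis (f i))"
  using assms by induction (auto simp flip: cis_mult)

text \<open>
  The digits are independent, so the average of \<open>cis (k * angle)\<close> over all subsets of \<open>D\<close> factorises
  into one factor \<open>(1 + cis (2 * pi * k / 2 ^ i)) / 2\<close> for each position.
\<close>
lemma norm_moment_digit_angle:
  assumes "finite D"
  shows "(cmod ((\<Sum>S\<in>Pow D. cis (digit_angle S) ^ k) / 2 ^ card D))\<^sup>2 = riesz_product D k"
proof -
  have "(\<Sum>S\<in>Pow D. cis (digit_angle S) ^ k) = (\<Sum>S\<in>Pow D. \<Prod>i\<in>S. cis (2 * pi * real k / 2 ^ i))"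
  proof (rule sum.cong[OF refl])
    fix S assume "S \<in> Pow D"
    hence "finite S" using assms finite_subset by auto
    thus "cis (digit_angle S) ^ k = (\<Prod>i\<in>S. cis (2 * pi * real k / 2 ^ i))"
      by (simp add: Complex.DeMoivre digit_angle_def flip: cis_sum_eq_prod)
         (simp add: sum_distrib_left power_one_over field_simps)
  qed
  also have "\<dots> = (\<Prod>i\<in>D. cis (2 * pi * real k / 2 ^ i) + 1)"
    by (subst prod_add[OF assms]) simp
  finally have "(cmod ((\<Sum>S\<in>Pow D. cis (digit_angle S) ^ k) / 2 ^ card D))\<^sup>2
      = (\<Prod>i\<in>D. (cmod (1 + cis (2 * pi * real k / 2 ^ i)))\<^sup>2) / 4 ^ card D"
    by (simp add: norm_divide norm_power power_divide add.commute prod_norm[symmetric] prod_power_distrib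
          power2_eq_square power_mult_distrib[symmetric] prod.distrib)
  also have "\<dots> = riesz_product D k"
    by (simp add: norm_one_plus_cis riesz_product_def prod.distrib)
  finally show ?thesis .
qed

lemma cos_add_nat_pi_squared: "(cos (x + real n * pi))\<^sup>2 = (cos x)\<^sup>2"
  by (simp add: cos_add cos_npi sin_npi power_mult_distrib flip: power_mult)

lemma riesz_product_periodic:
  assumes "D \<subseteq> {1..m}"
  shows "riesz_product D (k + 2 ^ m) = riesz_product D k"
  unfolding riesz_product_def
proof (rule prod.cong[OF refl])
  fix i assume "i \<in> D"
  hence "m = i + (m - i)" using assms by auto
  hence e: "(2::real) ^ m = 2 ^ i * 2 ^ (m - i)" by (metis power_add)
  have "pi * real (k + 2 ^ m) / 2 ^ i = pi * real k / 2 ^ i + real (2 ^ (m - i)) * pi"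
    by (simp add: e field_simps)
  thus "(cos (pi * real (k + 2 ^ m) / 2 ^ i))\<^sup>2 = (cos (pi * real k / 2 ^ i))\<^sup>2"
    by (simp only: cos_add_nat_pi_squared)
qed

lemma riesz_product_reflect:
  assumes "D \<subseteq> {1..m}" "k \<le> 2 ^ m"
  shows "riesz_product D (2 ^ m - k) = riesz_product D k"
  unfolding riesz_product_def
proof (rule prod.cong[OF refl])
  fix i assume "i \<in> D"
  hence "m = i + (m - i)" using assms by auto
  hence e: "(2::real) ^ m = 2 ^ i * 2 ^ (m - i)" by (metis power_add)
  have "pi * real (2 ^ m - k) / 2 ^ i = - (pi * real k / 2 ^ i) + real (2 ^ (m - i)) * pi"
    using assms(2) by (simp add: e of_nat_diff field_simps)
  thus "(cos (pi * real (2 ^ m - k) / 2 ^ i))\<^sup>2 = (cos (pi * real k / 2 ^ i))\<^sup>2"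
    by (simp only: cos_add_nat_pi_squared cos_minus)
qed

lemma digits_Suc:
  "A \<inter> {Suc 0..Suc m} = (if Suc m \<in> A then insert (Suc m) (A \<inter> {Suc 0..m}) else A \<inter> {Suc 0..m})"
  by (auto simp: le_Suc_eq)

text \<open>
  One step of the induction pairs \<open>k\<close> with \<open>k + 2 ^ m\<close>. The old factors agree at both, while a new
  factor turns from a squared cosine into the squared sine of the same angle, so that the pair contributes one
  copy of the old product if the position \<open>m + 1\<close> is free and two copies otherwise.
\<close>
lemma sum_riesz_product:
  "(\<Sum>k<2 ^ m. riesz_product (A \<inter> {1..m}) k) = 2 ^ m / 2 ^ card (A \<inter> {1..m})"
proof (induction m)
  case 0
  show ?case by (simp add: riesz_product_def)
next
  case (Suc m)
  let ?D = "A \<inter> {1..m}" and ?E = "A \<inter> {1..Suc m}"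
  have "(\<Sum>k<2 ^ Suc m. riesz_product ?E k)
      = (\<Sum>k<2 ^ m. riesz_product ?E k) + (\<Sum>k<2 ^ m. riesz_product ?E (k + 2 ^ m))"
  proof -
    have "{..<2 ^ Suc m} = {..<2 ^ m} \<union> {2 ^ m..<2 ^ m + 2 ^ m :: nat}" by auto
    hence "(\<Sum>k<2 ^ Suc m. riesz_product ?E k)
        = (\<Sum>k<2 ^ m. riesz_product ?E k) + (\<Sum>k\<in>{2 ^ m..<2 ^ m + 2 ^ m}. riesz_product ?E k)"
      by (metis sum.union_disjoint[OF finite_lessThan finite_atLeastLessThan ivl_disj_int_one(2)])
    also have "(\<Sum>k\<in>{2 ^ m..<2 ^ m + 2 ^ m}. riesz_product ?E k) = (\<Sum>k<2 ^ m. riesz_product ?E (k + 2 ^ m))"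
      using sum.shift_bounds_nat_ivl[of "riesz_product ?E" 0 "2 ^ m" "2 ^ m"] by (simp add: lessThan_atLeast0)
    finally show ?thesis .
  qed
  also have "\<dots> = (\<Sum>k<2 ^ m. riesz_product ?D k) * (if Suc m \<in> A then 1 else 2)"
  proof (cases "Suc m \<in> A")
    case False
    hence "?E = ?D" by (simp add: digits_Suc)
    thus ?thesis using False by (simp add: riesz_product_periodic)
  next
    case True
    have E: "riesz_product ?E k = (cos (pi * real k / 2 ^ Suc m))\<^sup>2 * riesz_product ?D k" for k
      using True by (simp add: digits_Suc riesz_product_def)
    have "pi * real (k + 2 ^ m) / 2 ^ Suc m = pi * real k / 2 ^ Suc m + pi / 2" for k
      by (simp add: field_simps)
    hence c: "(cos (pi * real (k + 2 ^ m) / 2 ^ Suc m))\<^sup>2 = (sin (pi * real k / 2 ^ Suc m))\<^sup>2" for k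
      by (simp only: cos_add cos_pi_half sin_pi_half) simp
    have "riesz_product ?E k + riesz_product ?E (k + 2 ^ m) = riesz_product ?D k" for k
      unfolding E c by (subst riesz_product_periodic) (auto simp: cos_squared_eq algebra_simps)
    thus ?thesis using True by (simp flip: sum.distrib)
  qed
  also have "\<dots> = 2 ^ Suc m / 2 ^ card ?E"
    by (subst Suc.IH) (auto simp: digits_Suc)
  finally show ?case .
qed

text \<open>
  The factors are even and have period \<open>2 ^ m\<close> in \<open>k\<close>, so the frequencies up to \<open>2 ^ (m - 1)\<close> carry half
  of the full sum; the summand 1 is the term \<open>k = 0\<close>.
\<close>
lemma sum_riesz_product_half:
  assumes "m \<ge> 1"
  shows "2 ^ m / 2 ^ card (A \<inter> {1..m}) \<le> 1 + 2 * (\<Sum>k\<in>{1..2 ^ (m - 1)}. riesz_product (A \<inter> {1..m}) k)"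
proof -
  let ?P = "riesz_product (A \<inter> {1..m})" and ?h = "2 ^ (m - 1) :: nat"
  have h: "2 ^ m = 2 * ?h" using assms by (cases m) auto
  have h1: "?h \<ge> 1" by simp
  have un: "{..<2 * ?h} = insert 0 ({1..<?h} \<union> {?h..<2 * ?h})" using h1 by auto
  have "(\<Sum>k<2 ^ m. ?P k) = 1 + (\<Sum>k\<in>{1..<?h} \<union> {?h..<2 * ?h}. ?P k)"
    unfolding h un using h1 by (subst sum.insert) auto
  also have "(\<Sum>k\<in>{1..<?h} \<union> {?h..<2 * ?h}. ?P k) = (\<Sum>k\<in>{1..<?h}. ?P k) + (\<Sum>k\<in>{?h..<2 * ?h}. ?P k)"
    by (rule sum.union_disjoint) auto
  also have "(\<Sum>k\<in>{?h..<2 * ?h}. ?P k) = (\<Sum>k\<in>{1..?h}. ?P k)"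
    by (rule sum.reindex_bij_witness[of _ "\<lambda>k. 2 ^ m - k" "\<lambda>k. 2 ^ m - k"])
       (use h riesz_product_reflect[of "A \<inter> {1..m}" m] in \<open>auto simp: h[symmetric]\<close>)
  also have "(\<Sum>k\<in>{1..<?h}. ?P k) \<le> (\<Sum>k\<in>{1..?h}. ?P k)"
    by (intro sum_mono2) (auto simp: riesz_product_nonneg)
  finally show ?thesis unfolding sum_riesz_product by linarith
qed

text \<open>
  For such small \<open>k\<close> the angles \<open>pi * k / 2 ^ i\<close>, \<open>i > m\<close>, start at no more than \<open>pi / 4\<close> and decay
  geometrically. The product of their squared cosines is at least 1 minus the sum of the squared sines, and that
  sum is at most \<open>(pi\<^sup>2 / 16) * (4 / 3) = pi\<^sup>2 / 12 < 7 / 8\<close>.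
\<close>
lemma riesz_product_tail:
  assumes m: "1 \<le> m" "m \<le> K" and k: "k \<le> 2 ^ (m - 1)"
  shows "riesz_product (A \<inter> {1..K}) k \<ge> riesz_product (A \<inter> {1..m}) k / 8"
proof -
  let ?T = "A \<inter> {m<..K}"
  have "A \<inter> {1..K} = (A \<inter> {1..m}) \<union> ?T" using m by auto
  hence split: "riesz_product (A \<inter> {1..K}) k = riesz_product (A \<inter> {1..m}) k * riesz_product ?T k"
    unfolding riesz_product_def by (simp only:) (rule prod.union_disjoint, auto)
  have geo: "(\<Sum>j<n. (1/4::real) ^ j) \<le> 4 / 3" for n
    by (subst sum_gp_strict) (auto simp: power_one_over field_simps)
  have "(\<Sum>i\<in>?T. (sin (pi * real k / 2 ^ i))\<^sup>2) \<le> (\<Sum>i\<in>{m<..K}. (pi\<^sup>2 / 16) * (1/4) ^ (i - Suc m))"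
  proof (intro order.trans[OF sum_mono2 sum_mono])
    fix i assume i: "i \<in> {m<..K}"
    have e: "(2::real) ^ i = 4 * 2 ^ (m - 1) * 2 ^ (i - Suc m)"
    proof -
      have "i = 2 + (m - 1) + (i - Suc m)" using i m by auto
      hence "(2::real) ^ i = 2 ^ (2 + (m - 1) + (i - Suc m))" by (rule arg_cong)
      thus ?thesis by (simp only: power_add) simp
    qed
    have kr: "real k \<le> 2 ^ (m - 1)" using k by (metis of_nat_le_iff of_nat_numeral of_nat_power)
    have "\<bar>sin (pi * real k / 2 ^ i)\<bar> \<le> \<bar>pi * real k / 2 ^ i\<bar>" by (rule abs_sin_x_le_abs_x)
    also have "\<dots> = pi * real k / 2 ^ i" by simp
    also have "\<dots> \<le> pi * 2 ^ (m - 1) / 2 ^ i" using kr by (intro divide_right_mono mult_left_mono) auto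
    also have "\<dots> = (pi / 4) * (1/2) ^ (i - Suc m)" by (simp add: e power_one_over field_simps)
    finally have "\<bar>sin (pi * real k / 2 ^ i)\<bar>\<^sup>2 \<le> ((pi / 4) * (1/2) ^ (i - Suc m))\<^sup>2"
      by (intro power_mono) auto
    also have "\<dots> = (pi\<^sup>2 / 16) * (1/4) ^ (i - Suc m)"
      by (simp add: power_mult_distrib power_divide power_one_over flip: power_mult)
         (simp add: power_mult mult.commute)
    finally show "(sin (pi * real k / 2 ^ i))\<^sup>2 \<le> (pi\<^sup>2 / 16) * (1/4) ^ (i - Suc m)" by simp
  qed auto
  also have "\<dots> = (pi\<^sup>2 / 16) * (\<Sum>j<K - m. (1/4) ^ j)"
    unfolding sum_distrib_left
    by (rule sum.reindex_bij_witness[of _ "\<lambda>j. j + Suc m" "\<lambda>i. i - Suc m"]) auto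
  also have "\<dots> \<le> (pi\<^sup>2 / 16) * (4 / 3)" by (intro mult_left_mono geo) auto
  also have "\<dots> \<le> 7 / 8"
  proof -
    have "pi \<le> 3.2" using pi_approx by simp
    hence "pi\<^sup>2 \<le> 3.2\<^sup>2" by (intro power_mono) auto
    thus ?thesis by (simp add: power2_eq_square)
  qed
  finally have "1 / 8 \<le> 1 - (\<Sum>i\<in>?T. (sin (pi * real k / 2 ^ i))\<^sup>2)" by simp
  also have "\<dots> \<le> (\<Prod>i\<in>?T. 1 - (sin (pi * real k / 2 ^ i))\<^sup>2)"
    by (intro Weierstrass_prod_ineq) (auto simp: abs_square_le_1)
  also have "\<dots> = riesz_product ?T k"
    by (simp add: riesz_product_def cos_squared_eq)
  finally have "1 / 8 \<le> riesz_product ?T k" .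
  from mult_left_mono[OF this riesz_product_nonneg[of "A \<inter> {1..m}" k]] show ?thesis
    unfolding split by simp
qed

text \<open>
  This geometric sum starts at the first \<open>m\<close> with \<open>k \<le> 2 ^ (m - 1)\<close>. It replaces the weight \<open>1 / k\<close> in the
  energy by dyadic blocks.
\<close>
lemma sum_dyadic_le_inverse:
  assumes "k \<ge> 1"
  shows "(\<Sum>m | m \<in> {1..K} \<and> k \<le> 2 ^ (m - 1). (1/2) ^ m) \<le> 1 / real k"
proof -
  have "\<exists>m. m \<ge> 1 \<and> k \<le> 2 ^ (m - 1)"
    by (rule exI[of _ "Suc k"]) (use less_exp[of k] in auto)
  define m0 where "m0 = (LEAST m. m \<ge> 1 \<and> k \<le> 2 ^ (m - 1))"
  have m0: "m0 \<ge> 1" "k \<le> 2 ^ (m0 - 1)"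
    using LeastI_ex[OF \<open>\<exists>m. m \<ge> 1 \<and> k \<le> 2 ^ (m - 1)\<close>] unfolding m0_def by auto
  have "(\<Sum>m | m \<in> {1..K} \<and> k \<le> 2 ^ (m - 1). (1/2) ^ m) \<le> (\<Sum>m\<in>{m0..K}. (1/2::real) ^ m)"
    by (intro sum_mono2) (auto simp: m0_def intro: Least_le)
  also have "\<dots> \<le> 2 * (1/2) ^ m0"
    using sum_gp[of "1/2::real" m0 K] by (auto simp: field_simps)
  also have "\<dots> = 1 / real (2 ^ (m0 - 1))"
    using m0(1) by (cases m0) (auto simp: power_one_over)
  also have "\<dots> \<le> 1 / real k"
    using assms m0(2) by (intro divide_left_mono) (auto simp del: of_nat_power)
  finally show ?thesis .
qed

text \<open>
  After replacing \<open>1 / k\<close> by a sum over dyadic scales and exchanging the sums, scale \<open>m\<close> sees the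
  frequencies up to \<open>2 ^ (m - 1)\<close>. There the full product is comparable to its part up to position \<open>m\<close>, whose sum
  \<open>sum_riesz_product_half\<close> estimates. The subtracted 1 collects the terms \<open>k = 0\<close>, weighted by \<open>2 ^ -m\<close>.
\<close>
lemma riesz_energy_ge:
  "(\<Sum>k\<in>{1..2 ^ (K - 1)}. riesz_product (A \<inter> {1..K}) k / real k)
     \<ge> ((\<Sum>m\<in>{1..K}. 1 / 2 ^ card (A \<inter> {1..m})) - 1) / 16"
proof -
  let ?P = "\<lambda>m k. riesz_product (A \<inter> {1..m}) k"
  have geo: "(\<Sum>m\<in>{1..K}. (1/2::real) ^ m) \<le> 1"
    using sum_gp[of "1/2::real" 1 K] by auto
  have "((\<Sum>m\<in>{1..K}. 1 / 2 ^ card (A \<inter> {1..m})) - 1) / 16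
      \<le> (\<Sum>m\<in>{1..K}. 1 / 2 ^ card (A \<inter> {1..m}) - (1/2::real) ^ m) / 16"
    using geo by (simp add: sum_subtractf)
  also have "\<dots> = (\<Sum>m\<in>{1..K}. (1/2) ^ m * ((2 ^ m / 2 ^ card (A \<inter> {1..m}) - 1) / 16))"
    unfolding sum_divide_distrib by (intro sum.cong refl) (simp add: power_one_over field_simps)
  also have "\<dots> \<le> (\<Sum>m\<in>{1..K}. (1/2) ^ m * (\<Sum>k\<in>{1..2 ^ (m - 1)}. ?P K k))"
  proof (intro sum_mono mult_left_mono)
    fix m assume m: "m \<in> {1..K}"
    have "(2 ^ m / 2 ^ card (A \<inter> {1..m}) - 1) / 16 \<le> (\<Sum>k\<in>{1..2 ^ (m - 1)}. ?P m k / 8)"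
    proof -
      have "(x - 1) / 16 \<le> y / 8" if "x \<le> 1 + 2 * y" for x y :: real using that by simp
      from this[OF sum_riesz_product_half] m show ?thesis unfolding sum_divide_distrib[symmetric] by simp
    qed
    also have "\<dots> \<le> (\<Sum>k\<in>{1..2 ^ (m - 1)}. ?P K k)"
      using m by (intro sum_mono riesz_product_tail) auto
    finally show "(2 ^ m / 2 ^ card (A \<inter> {1..m}) - 1) / 16 \<le> (\<Sum>k\<in>{1..2 ^ (m - 1)}. ?P K k)" .
  qed auto
  also have "\<dots> = (\<Sum>m\<in>{1..K}. \<Sum>k\<in>{1..2 ^ (K - 1)}. if k \<le> 2 ^ (m - 1) then (1/2) ^ m * ?P K k else 0)"
  proof (intro sum.cong refl)
    fix m assume "m \<in> {1..K}"
    hence "(2::nat) ^ (m - 1) \<le> 2 ^ (K - 1)" by (intro power_increasing) auto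
    hence "{1..2 ^ (m - 1)} = {k \<in> {1..2 ^ (K - 1)}. k \<le> (2::nat) ^ (m - 1)}"
      using order.trans by fastforce
    thus "(1/2) ^ m * (\<Sum>k\<in>{1..2 ^ (m - 1)}. ?P K k)
        = (\<Sum>k\<in>{1..2 ^ (K - 1)}. if k \<le> 2 ^ (m - 1) then (1/2) ^ m * ?P K k else 0)"
      by (simp only: sum.inter_filter finite_atLeastAtMost sum_distrib_left) (intro sum.cong refl, simp)
  qed
  also have "\<dots> = (\<Sum>k\<in>{1..2 ^ (K - 1)}. \<Sum>m\<in>{1..K}. if k \<le> 2 ^ (m - 1) then (1/2) ^ m * ?P K k else 0)"
    by (rule sum.swap)
  also have "\<dots> = (\<Sum>k\<in>{1..2 ^ (K - 1)}. ?P K k * (\<Sum>m | m \<in> {1..K} \<and> k \<le> 2 ^ (m - 1). (1/2) ^ m))"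
    unfolding sum_distrib_left
    by (rule sum.cong[OF refl], subst sum.inter_filter) (auto intro!: sum.cong)
  also have "\<dots> \<le> (\<Sum>k\<in>{1..2 ^ (K - 1)}. ?P K k * (1 / real k))"
    by (intro sum_mono mult_left_mono sum_dyadic_le_inverse riesz_product_nonneg) auto
  finally show ?thesis by simp
qed

section \<open>Counting Cantor points in arcs\<close>

text \<open>
  The digits up to position \<open>m\<close> determine an integer \<open>q\<close> with \<open>2 ^ m * x \<in> {q..q + 1}\<close>, where \<open>x\<close> is the
  number coded by \<open>S\<close>. The condition on \<open>x\<close> confines \<open>q\<close> to an interval of length 3, hence to at most 4 values, and
  only the digits beyond \<open>m\<close> remain free.
\<close>
lemma card_digits_near_le:
  fixes y :: real
  assumes "m \<le> K"
  shows "real (card {S \<in> Pow (A \<inter> {1..K}). \<bar>(\<Sum>i\<in>S. (1 / 2) ^ i) - y\<bar> \<le> (1 / 2) ^ m})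
           \<le> 4 * 2 ^ card (A \<inter> {1..K}) / 2 ^ card (A \<inter> {1..m})"
proof -
  define X where "X = {S \<in> Pow (A \<inter> {1..K}). \<bar>(\<Sum>i\<in>S. (1 / 2) ^ i) - y\<bar> \<le> (1 / 2) ^ m}"
  \<comment> \<open>the integer whose binary expansion consists of the digits of \<open>S\<close> up to position \<open>m\<close>\<close>
  define q where "q S = set_encode ((\<lambda>i. m - i) ` (S \<inter> {1..m}))" for S
  define Q where "Q = {\<lceil>2 ^ m * y - 2\<rceil>..\<lfloor>2 ^ m * y + 1\<rfloor>}"
  let ?T = "A \<inter> {m<..K}"
  have tail: "(\<Sum>i\<in>S \<inter> {m<..}. (1 / 2) ^ i) \<le> (1 / 2 :: real) ^ m" if "S \<subseteq> {1..K}" for S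
  proof -
    have "(\<Sum>i\<in>S \<inter> {m<..}. (1 / 2 :: real) ^ i) \<le> (\<Sum>i\<in>{Suc m..K}. (1 / 2) ^ i)"
      using that by (intro sum_mono2) auto
    also have "\<dots> \<le> (1 / 2) ^ m"
      using sum_gp[of "1/2::real" "Suc m" K] by (auto simp: field_simps)
    finally show ?thesis .
  qed
  have head: "2 ^ m * (\<Sum>i\<in>S \<inter> {1..m}. (1 / 2 :: real) ^ i) = real (q S)" for S
  proof -
    have "real (q S) = (\<Sum>i\<in>S \<inter> {1..m}. 2 ^ (m - i))"
      unfolding q_def set_encode_def by (subst sum.reindex) (auto simp: inj_on_def)
    also have "\<dots> = (\<Sum>i\<in>S \<inter> {1..m}. 2 ^ m * (1 / 2) ^ i)"
      by (intro sum.cong refl) (auto simp: power_diff power_one_over)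
    finally show ?thesis by (simp add: sum_distrib_left)
  qed
  have inQ: "int (q S) \<in> Q" if "S \<in> X" for S
  proof -
    have S: "S \<subseteq> {1..K}" using that by (auto simp: X_def)
    hence "finite S" using finite_subset by blast
    moreover have "S = (S \<inter> {1..m}) \<union> (S \<inter> {m<..})" using S by auto
    ultimately have "(\<Sum>i\<in>S. (1 / 2 :: real) ^ i) = (\<Sum>i\<in>S \<inter> {1..m}. (1 / 2) ^ i) + (\<Sum>i\<in>S \<inter> {m<..}. (1 / 2) ^ i)"
      by (metis (no_types, lifting) sum.union_disjoint finite_Un Int_assoc Int_commute disjoint_iff
           IntD2 atLeastAtMost_iff greaterThan_iff not_le)
    hence eq: "2 ^ m * (\<Sum>i\<in>S. (1 / 2 :: real) ^ i) = real (q S) + 2 ^ m * (\<Sum>i\<in>S \<inter> {m<..}. (1 / 2) ^ i)"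
      using head[of S] by (simp add: distrib_left)
    have t: "0 \<le> 2 ^ m * (\<Sum>i\<in>S \<inter> {m<..}. (1 / 2 :: real) ^ i)" 
      "2 ^ m * (\<Sum>i\<in>S \<inter> {m<..}. (1 / 2 :: real) ^ i) \<le> 1"
      using mult_left_mono[OF tail[OF S], of "2 ^ m"]
      by (auto intro!: mult_nonneg_nonneg sum_nonneg simp: power_one_over)
    have "\<bar>(\<Sum>i\<in>S. (1 / 2) ^ i) - y\<bar> \<le> (1 / 2) ^ m" using that by (auto simp: X_def)
    hence "2 ^ m * \<bar>(\<Sum>i\<in>S. (1 / 2) ^ i) - y\<bar> \<le> 2 ^ m * (1 / 2) ^ m" by (intro mult_left_mono) auto
    also have "2 ^ m * (1 / 2 :: real) ^ m = 1" by (simp add: power_one_over)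
    also have "2 ^ m * \<bar>(\<Sum>i\<in>S. (1 / 2) ^ i) - y\<bar> = \<bar>2 ^ m * (\<Sum>i\<in>S. (1 / 2) ^ i) - 2 ^ m * y\<bar>"
      by (simp add: abs_mult flip: right_diff_distrib)
    finally have "2 ^ m * y - 2 \<le> real (q S)" "real (q S) \<le> 2 ^ m * y + 1"
      using t unfolding eq by linarith+
    thus ?thesis unfolding Q_def atLeastAtMost_iff ceiling_le_iff le_floor_iff by simp
  qed
  have inj: "inj_on (\<lambda>S. (int (q S), S \<inter> ?T)) X"
  proof (rule inj_onI)
    fix S S' assume S: "S \<in> X" "S' \<in> X" and e: "(int (q S), S \<inter> ?T) = (int (q S'), S' \<inter> ?T)"
    have "(\<lambda>i. m - i) ` (S \<inter> {1..m}) = (\<lambda>i. m - i) ` (S' \<inter> {1..m})"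
      by (rule inj_onD[OF inj_on_set_encode]) (use e in \<open>auto simp: q_def\<close>)
    moreover have "inj_on (\<lambda>i. m - i) {1..m}" by (auto simp: inj_on_def)
    ultimately have "S \<inter> {1..m} = S' \<inter> {1..m}"
      by (subst (asm) inj_on_image_eq_iff[of _ "{1..m}"]) auto
    moreover have "S = (S \<inter> {1..m}) \<union> (S \<inter> ?T)" "S' = (S' \<inter> {1..m}) \<union> (S' \<inter> ?T)"
      using S by (auto simp: X_def)
    ultimately show "S = S'" using e by auto
  qed
  have "card X \<le> card (Q \<times> Pow ?T)"
  proof (rule card_inj_on_le[OF inj])
    show "(\<lambda>S. (int (q S), S \<inter> ?T)) ` X \<subseteq> Q \<times> Pow ?T" using inQ by blast
    show "finite (Q \<times> Pow ?T)" by (simp add: Q_def)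
  qed
  also have "\<dots> = card Q * 2 ^ card ?T" by (simp add: card_cartesian_product card_Pow del: Pow_Int_eq)
  also have "\<dots> \<le> 4 * 2 ^ card ?T"
  proof (rule mult_right_mono)
    have "of_int \<lfloor>2 ^ m * y + 1\<rfloor> \<le> 2 ^ m * y + 1" "2 ^ m * y - 2 \<le> of_int \<lceil>2 ^ m * y - 2\<rceil>"
      by (rule of_int_floor_le, rule le_of_int_ceiling)
    hence "\<lfloor>2 ^ m * y + 1\<rfloor> - \<lceil>2 ^ m * y - 2\<rceil> \<le> 3" by linarith
    thus "card Q \<le> 4" unfolding Q_def card_atLeastAtMost_int by linarith
  qed auto
  finally have "card X \<le> 4 * 2 ^ card ?T" .
  hence "real (card X) \<le> real (4 * 2 ^ card ?T)" by (rule of_nat_mono)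
  also have "\<dots> = 4 * 2 ^ card (A \<inter> {1..K}) / 2 ^ card (A \<inter> {1..m})"
  proof -
    have "A \<inter> {1..K} = (A \<inter> {1..m}) \<union> ?T" using assms by auto
    moreover have "card ((A \<inter> {1..m}) \<union> ?T) = card (A \<inter> {1..m}) + card ?T"
      by (rule card_Un_disjoint) auto
    ultimately show ?thesis by (simp add: power_add)
  qed
  finally show ?thesis unfolding X_def .
qed

text \<open>
  An arc may be presented by any interval \<open>J\<close> of the line. Shifting by a multiple of \<open>2 * pi\<close> and
  cutting at \<open>2 * pi\<close> moves a segment of \<open>J\<close> that is shorter than a full turn into the fundamental domain without
  changing its length.
\<close>
lemma arc_parameter_diameter_le:
  assumes J: "is_interval J" and I: "0 < arclength (cis ` J)" "arclength (cis ` J) < 1"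
    and ab: "a \<in> J" "b \<in> J"
  shows "b - a \<le> arclength (cis ` J)"
proof (rule ccontr)
  let ?l = "arclength (cis ` J)" and ?X = "{t \<in> {0..<2 * pi}. cis t \<in> cis ` J}"
  assume "\<not> b - a \<le> ?l"
  \<comment> \<open>truncating to length at most 1 keeps the segment from wrapping around the whole circle\<close>
  define b' where "b' = min b (a + 1)"
  have b': "b' - a > ?l" "b' - a \<le> 1" "a < b'" "b' \<le> b"
    using I \<open>\<not> b - a \<le> ?l\<close> by (auto simp: b'_def)
  define n where "n = \<lfloor>a / (2 * pi)\<rfloor>"
  define u v where "u = a - of_int n * (2 * pi)" and "v = b' - of_int n * (2 * pi)"
  have "of_int n \<le> a / (2 * pi)" "a / (2 * pi) < of_int n + 1"
    unfolding n_def by linarith+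
  hence u: "0 \<le> u" "u < 2 * pi" by (auto simp: u_def field_simps)
  have v: "v - u = b' - a" by (simp add: u_def v_def)
  have J': "t \<in> J" if "a \<le> t" "t \<le> b'" for t
    using J ab that b'(4) unfolding is_interval_1 by (meson order.trans)
  have per: "cis (t + of_int k * (2 * pi)) = cis t" for t k
  proof -
    have "cis (t + of_int k * (2 * pi)) = cis t * cis (2 * pi * of_int k)" 
      by (simp add: cis_mult mult.commute)
    also have "cis (2 * pi * of_int k) = 1" by (rule cis_multiple_2pi) auto
    finally show ?thesis by simp
  qed
  have X1: "t \<in> ?X" if "u \<le> t" "t \<le> v" "t < 2 * pi" for t
  proof -
    have "t + of_int n * (2 * pi) \<in> J" using that by (intro J') (auto simp: u_def v_def)
    thus ?thesis using that u per[of t n] by (auto intro: rev_image_eqI)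
  qed
  have X2: "t \<in> ?X" if "0 \<le> t" "t \<le> v - 2 * pi" for t
  proof -
    have "t + of_int (n + 1) * (2 * pi) \<in> J"
      using that u by (intro J') (auto simp: u_def v_def algebra_simps)
    moreover have "t < 2 * pi" using that u v b'(2) pi_gt3 by linarith
    ultimately show ?thesis using that per[of t "n + 1"] by (auto intro: rev_image_eqI)
  qed
  have Xs: "?X \<in> sets lborel"
    using I(1) measure_notin_sets[of ?X lborel] unfolding arclength_def by force
  have Xf: "emeasure lborel ?X < \<infinity>"
    by (rule le_less_trans[OF emeasure_mono[of _ "{0..2 * pi}"]]) auto
  have X: "?X \<in> fmeasurable lborel" using Xs Xf by (rule fmeasurableI)
  have "b' - a \<le> measure lborel ?X"
  proof (cases "v \<le> 2 * pi")
    case True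
    have "b' - a = measure lborel {u..<v}" using v b' by simp
    also have "\<dots> \<le> measure lborel ?X"
      using X1 True by (intro measure_mono_fmeasurable X) auto
    finally show ?thesis .
  next
    case False
    have "v - 2 * pi < u" using v b'(2) pi_gt3 by linarith
    hence "measure lborel ({u..<2 * pi} \<union> {0..<v - 2 * pi}) = measure lborel {u..<2 * pi} + measure lborel {0..<v - 2 * pi}"
      by (intro measure_Union) (use u False in auto)
    also have "\<dots> = b' - a" using u v False by simp
    finally have "b' - a = measure lborel ({u..<2 * pi} \<union> {0..<v - 2 * pi})" ..
    also have "\<dots> \<le> measure lborel ?X"
      using X1 X2 False u by (intro measure_mono_fmeasurable X) auto
    finally show ?thesis .
  qed
  thus False using b' by (simp add: arclength_def)
qed

text \<open>
  Points of \<open>I\<close> have parameters close to one chosen parameter of the arc, up to full turns; the three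
  centers account for arcs that pass through the point 1 of the circle.
\<close>
lemma arc_covering_centers:
  assumes "circle_arc I" "0 < arclength I" "arclength I < 1"
  shows "\<exists>y. \<forall>x\<in>{0..1}. cis (2 * pi * x) \<in> I \<longrightarrow> (\<exists>j\<in>{-1, 0, 1}. \<bar>x - (y + j)\<bar> \<le> arclength I)"
proof -
  obtain J where J: "is_interval J" "I = cis ` J" using assms by (auto simp: circle_arc_def)
  have "J \<noteq> {}" using assms(2) J by (auto simp: arclength_def)
  then obtain a where a: "a \<in> J" by blast
  define y where "y = frac (a / (2 * pi))"
  have y: "0 \<le> y" "y < 1" by (auto simp: y_def frac_lt_1)
  have "\<exists>j\<in>{-1, 0, 1}. \<bar>x - (y + j)\<bar> \<le> arclength I" if x: "x \<in> {0..1}" and xI: "cis (2 * pi * x) \<in> I" for x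
  proof -
    obtain t where t: "t \<in> J" "cis (2 * pi * x) = cis t" using xI J by auto
    hence "sin (2 * pi * x) = sin t \<and> cos (2 * pi * x) = cos t" by (simp add: complex_eq_iff)
    then obtain n :: int where n: "2 * pi * x = t + 2 * pi * of_int n"
      unfolding sin_cos_eq_iff by blast
    have "\<bar>t - a\<bar> \<le> arclength I"
      using arc_parameter_diameter_le[OF J(1) _ _ a t(1)] arc_parameter_diameter_le[OF J(1) _ _ t(1) a] assms J(2)
      by auto
    hence "\<bar>t - a\<bar> / (2 * pi) \<le> arclength I / 1"
      using pi_gt3 by (intro frac_le) auto
    \<comment> \<open>the integer shift that moves the center \<open>y\<close> next to \<open>x\<close>\<close>
    moreover define j where "j = \<lfloor>a / (2 * pi)\<rfloor> + n"
    have "x - (y + of_int j) = (t - a) / (2 * pi)"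
      using n by (simp add: y_def j_def frac_def field_simps)
    ultimately have d: "\<bar>x - (y + of_int j)\<bar> \<le> arclength I" by simp
    hence "\<bar>x - (y + of_int j)\<bar> < 1" using assms by simp
    hence "j < 2" "j > -2" using x y by (auto simp: abs_less_iff)
    hence "j = -1 \<or> j = 0 \<or> j = 1" by linarith
    thus ?thesis using d by auto
  qed
  thus ?thesis by blast
qed

lemma card_digits_in_arc_le:
  assumes I: "circle_arc I" "0 < arclength I" "arclength I < 1" and m: "arclength I \<le> (1 / 2) ^ m" "m \<le> K"
  shows "real (card {S \<in> Pow (A \<inter> {1..K}). cis (digit_angle S) \<in> I})
           \<le> 12 * 2 ^ card (A \<inter> {1..K}) / 2 ^ card (A \<inter> {1..m})"
proof -
  let ?x = "\<lambda>S. (\<Sum>i\<in>S. (1 / 2 :: real) ^ i)"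
  obtain y where y: "\<And>x. x \<in> {0..1} \<Longrightarrow> cis (2 * pi * x) \<in> I \<Longrightarrow> \<exists>j\<in>{-1, 0, 1}. \<bar>x - (y + j)\<bar> \<le> arclength I"
    using arc_covering_centers[OF I] by blast
  define X where "X j = {S \<in> Pow (A \<inter> {1..K}). \<bar>?x S - (y + j)\<bar> \<le> (1 / 2) ^ m}" for j
  have fin: "finite (X j)" for j by (simp add: X_def)
  have "{S \<in> Pow (A \<inter> {1..K}). cis (digit_angle S) \<in> I} \<subseteq> (\<Union>j\<in>{-1, 0, 1}. X j)"
  proof
    fix S assume S: "S \<in> {S \<in> Pow (A \<inter> {1..K}). cis (digit_angle S) \<in> I}"
    have "?x S \<le> (\<Sum>i\<in>{1..K}. (1 / 2) ^ i)" using S by (intro sum_mono2) auto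
    also have "\<dots> \<le> 1" using sum_gp[of "1/2::real" 1 K] by auto
    finally have "?x S \<in> {0..1}" by (auto intro: sum_nonneg)
    moreover have "cis (2 * pi * ?x S) \<in> I" using S by (simp add: digit_angle_def)
    ultimately obtain j where "j \<in> {-1, 0, 1}" "\<bar>?x S - (y + j)\<bar> \<le> arclength I"
      using y by blast
    thus "S \<in> (\<Union>j\<in>{-1, 0, 1}. X j)" using S m(1) by (auto simp: X_def intro: order.trans)
  qed
  hence "card {S \<in> Pow (A \<inter> {1..K}). cis (digit_angle S) \<in> I} \<le> card (\<Union>j\<in>{-1, 0, 1}. X j)"
    by (intro card_mono) (auto simp: fin)
  also have "\<dots> \<le> (\<Sum>j\<in>{-1, 0, 1}. card (X j))" by (rule card_UN_le) simp
  finally have "real (card {S \<in> Pow (A \<inter> {1..K}). cis (digit_angle S) \<in> I})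
      \<le> real (\<Sum>j\<in>{-1, 0, 1}. card (X j))"
    by (rule of_nat_mono)
  also have "\<dots> = (\<Sum>j\<in>{-1, 0, 1}. real (card (X j)))" by (rule of_nat_sum)
  also have "\<dots> \<le> (\<Sum>j\<in>{-1, 0, 1::real}. 4 * 2 ^ card (A \<inter> {1..K}) / 2 ^ card (A \<inter> {1..m}))"
    unfolding X_def by (intro sum_mono card_digits_near_le m)
  also have "\<dots> = 12 * 2 ^ card (A \<inter> {1..K}) / 2 ^ card (A \<inter> {1..m})" by simp
  finally show ?thesis .
qed

section \<open>Fitting the digits to the gauge\<close>

lemma dyadic_scale:
  fixes x :: real
  assumes "0 < x" "x \<le> 1"
  obtains m :: nat where "(1 / 2) ^ Suc m < x" "x \<le> (1 / 2) ^ m"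
proof -
  define m where "m = (LEAST m. (1 / 2) ^ Suc m < x)"
  obtain n where n: "(1 / 2 :: real) ^ n < x" using real_arch_pow_inv[OF assms(1), of "1 / 2"] by auto
  moreover have "(1 / 2 :: real) ^ Suc n \<le> (1 / 2) ^ n" by simp
  ultimately have "(1 / 2) ^ Suc n < x" by linarith
  hence 1: "(1 / 2) ^ Suc m < x" unfolding m_def by (rule LeastI)
  have 2: "x \<le> (1 / 2) ^ m"
  proof (cases m)
    case (Suc k)
    hence "\<not> (1 / 2) ^ Suc k < x" using not_less_Least[of k "\<lambda>m. (1 / 2) ^ Suc m < x"] by (auto simp: m_def)
    thus ?thesis using Suc by simp
  qed (use assms in simp)
  show ?thesis using that 1 2 by blast
qed

lemma dyadic_in_gauge_domain: "(1 / 2 :: real) ^ m \<in> {0<..2 * pi}"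
proof -
  have "(1 / 2 :: real) ^ m \<le> 1" by (simp add: power_le_one)
  thus ?thesis using pi_gt3 by auto
qed

text \<open>
  This is where the monotonicity of \<open>\<phi> x / x\<close> enters: it keeps the number of free digits from growing by
  more than one per dyadic scale.
\<close>
lemma gauge_doubling:
  fixes \<phi> :: "real \<Rightarrow> real"
  assumes "strict_antimono_on {0<..2 * pi} (\<lambda>x. \<phi> x / x)"
  shows "\<phi> ((1 / 2) ^ m) < 2 * \<phi> ((1 / 2) ^ Suc m)"
proof -
  have "\<phi> ((1 / 2) ^ m) / (1 / 2) ^ m < \<phi> ((1 / 2) ^ Suc m) / (1 / 2) ^ Suc m"
    using monotone_onD[OF assms dyadic_in_gauge_domain[of "Suc m"] dyadic_in_gauge_domain[of m]] by simp
  thus ?thesis by (simp add: power_one_over field_simps)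
qed

text \<open>
  Let \<open>N m\<close> be the integer part of \<open>log 2 (\<phi> 1 / \<phi> (2 ^ -m))\<close>. By \<open>gauge_doubling\<close> the logarithm
  grows by at most 1 from one scale to the next, so \<open>N\<close> grows by steps of 0 or 1, and \<open>A\<close> is the set of scales at
  which it jumps. If \<open>\<phi>\<close> does not tend to 0 at 0, then \<open>A\<close> is finite.
\<close>
lemma gauge_digits:
  fixes \<phi> :: "real \<Rightarrow> real"
  assumes pos: "\<And>x. x \<in> {0<..2 * pi} \<Longrightarrow> \<phi> x > 0"
    and mono: "mono_on {0<..2 * pi} \<phi>"
    and anti: "strict_antimono_on {0<..2 * pi} (\<lambda>x. \<phi> x / x)"
  obtains A where
    "\<And>m. \<phi> ((1 / 2) ^ m) / \<phi> 1 \<le> 1 / 2 ^ card (A \<inter> {1..m})"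
    "\<And>m. 1 / 2 ^ card (A \<inter> {1..m}) \<le> 2 * \<phi> ((1 / 2) ^ m) / \<phi> 1"
proof -
  define p where "p m = \<phi> ((1 / 2) ^ m)" for m :: nat
  have p: "p m > 0" for m unfolding p_def by (intro pos dyadic_in_gauge_domain)
  have p1: "p (Suc m) \<le> p m" for m
    unfolding p_def by (intro mono_onD[OF mono] dyadic_in_gauge_domain) auto
  have p2: "p m \<le> 2 * p (Suc m)" for m
    using gauge_doubling[OF anti, of m] by (simp add: p_def)
  define L where "L m = log 2 (p 0 / p m)" for m
  have Lmono: "L m \<le> L (Suc m)" and Lstep: "L (Suc m) \<le> L m + 1" for m
  proof -
    show "L m \<le> L (Suc m)"
      unfolding L_def using p[of 0] p[of m] p[of "Suc m"] p1[of m] by (simp add: divide_left_mono)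
    have "p 0 / p (Suc m) \<le> 2 * (p 0 / p m)"
      using p2[of m] p[of 0] p[of m] p[of "Suc m"] by (simp add: field_simps)
    hence "L (Suc m) \<le> log 2 (2 * (p 0 / p m))"
      unfolding L_def using p[of 0] p[of m] p[of "Suc m"] by simp
    also have "\<dots> = L m + 1"
      unfolding L_def using p[of 0] p[of m] by (subst log_mult) auto
    finally show "L (Suc m) \<le> L m + 1" .
  qed
  have L0: "L m \<ge> 0" for m
  proof (induction m)
    case (Suc m) thus ?case using Lmono[of m] by linarith
  qed (use p[of 0] in \<open>simp add: L_def\<close>)
  define N where "N m = nat \<lfloor>L m\<rfloor>" for m
  have N: "real (N m) \<le> L m" "L m < real (N m) + 1" for m
    using L0[of m] unfolding N_def by (auto simp: of_nat_nat floor_le_iff)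
  have Nstep: "N (Suc m) = N m \<or> N (Suc m) = Suc (N m)" for m
  proof -
    have "\<lfloor>L m\<rfloor> \<le> \<lfloor>L (Suc m)\<rfloor>" by (rule floor_mono[OF Lmono])
    moreover have "\<lfloor>L (Suc m)\<rfloor> \<le> \<lfloor>L m + 1\<rfloor>" by (rule floor_mono[OF Lstep])
    moreover have "0 \<le> \<lfloor>L m\<rfloor>" using L0[of m] by simp
    ultimately show ?thesis unfolding N_def by auto
  qed
  define A where "A = {i. N i \<noteq> N (i - 1)}"
  have card: "card (A \<inter> {1..m}) = N m" for m
  proof (induction m)
    case 0
    show ?case using p[of 0] by (simp add: N_def L_def)
  next
    case (Suc m)
    thus ?case using Nstep[of m] by (auto simp: digits_Suc A_def)
  qed
  have b1: "2 ^ N m \<le> p 0 / p m" for m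
    using N(1)[of m] p[of 0] p[of m] unfolding L_def by (subst (asm) le_log_iff) (auto simp: powr_realpow)
  have b2: "p 0 / p m \<le> 2 * 2 ^ N m" for m
    using N(2)[of m] p[of 0] p[of m] unfolding L_def
    by (subst (asm) log_less_iff) (auto simp: powr_realpow powr_add)
  show ?thesis
  proof (rule that[of A])
    fix m
    show "\<phi> ((1 / 2) ^ m) / \<phi> 1 \<le> 1 / 2 ^ card (A \<inter> {1..m})"
      using b1[of m] p[of 0] p[of m] unfolding card by (simp add: p_def field_simps)
    show "1 / 2 ^ card (A \<inter> {1..m}) \<le> 2 * \<phi> ((1 / 2) ^ m) / \<phi> 1"
      using b2[of m] p[of 0] p[of m] unfolding card by (simp add: p_def field_simps)
  qed
qed

text \<open>
  On the dyadic interval from \<open>2 ^ -(m + 1)\<close> to \<open>2 ^ -m\<close> the integral of \<open>\<phi> x / x\<close> is at most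
  \<open>\<phi> (2 ^ -m)\<close>, and beyond 1 it is finite.
\<close>
lemma gauge_dyadic_sums_unbounded:
  fixes \<phi> :: "real \<Rightarrow> real"
  assumes pos: "\<And>x. x \<in> {0<..2 * pi} \<Longrightarrow> \<phi> x > 0"
    and mono: "mono_on {0<..2 * pi} \<phi>"
    and div: "(\<integral>\<^sup>+ x \<in> {0<..2 * pi}. ennreal (\<phi> x / x) \<partial>lborel) = \<infinity>"
  shows "\<exists>K. B \<le> (\<Sum>m\<in>{1..K}. \<phi> ((1 / 2) ^ m))"
proof (rule ccontr)
  assume neg: "\<nexists>K. B \<le> (\<Sum>m\<in>{1..K}. \<phi> ((1 / 2) ^ m))"
  define p where "p m = \<phi> ((1 / 2) ^ m)" for m :: nat
  have p: "p m \<ge> 0" for m unfolding p_def by (intro less_imp_le pos dyadic_in_gauge_domain)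
  have "summable p"
  proof (rule summableI_nonneg_bounded[of _ "p 0 + B"])
    fix n
    have "(\<Sum>m<n. p m) \<le> (\<Sum>m\<in>insert 0 {1..n}. p m)" by (intro sum_mono2) (auto simp: p)
    also have "\<dots> = p 0 + (\<Sum>m\<in>{1..n}. p m)" by simp
    also have "\<dots> \<le> p 0 + B" using neg unfolding p_def by (auto simp: not_le intro: less_imp_le)
    finally show "(\<Sum>m<n. p m) \<le> p 0 + B" .
  qed (rule p)
  hence fin: "(\<Sum>m. ennreal (p m)) < \<infinity>" using p by (simp add: suminf_ennreal_eq[OF _ summable_sums])
  define D where "D m = {(1 / 2 :: real) ^ Suc m<..(1 / 2) ^ m}" for m
  have bound: "ennreal (\<phi> x / x) * indicator {0<..2 * pi} x
      \<le> ennreal (\<phi> (2 * pi)) * indicator {1..2 * pi} x + (\<Sum>m. ennreal (p m * 2 ^ Suc m) * indicator (D m) x)" for x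
  proof (cases "x \<in> {0<..2 * pi}")
    case x: True
    show ?thesis
    proof (cases "x \<ge> 1")
      case True
      have "\<phi> x / x \<le> \<phi> x / 1" using True pos[OF x] by (intro divide_left_mono) auto
      also have "\<phi> x / 1 \<le> \<phi> (2 * pi)" using mono_onD[OF mono x, of "2 * pi"] x by simp
      finally have "ennreal (\<phi> x / x) * indicator {0<..2 * pi} x \<le> ennreal (\<phi> (2 * pi)) * indicator {1..2 * pi} x"
        using x True by (simp add: ennreal_leI)
      thus ?thesis by (rule add_increasing2[rotated]) simp
    next
      case False
      obtain m where m: "(1 / 2) ^ Suc m < x" "x \<le> (1 / 2) ^ m"
        using dyadic_scale[of x] x False by auto
      have "\<phi> x / x \<le> p m / (1 / 2) ^ Suc m"
        unfolding p_def using m x pos[OF x] p[of m, unfolded p_def] by (intro frac_le mono_onD[OF mono] dyadic_in_gauge_domain) auto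
      also have "\<dots> = p m * 2 ^ Suc m" by (simp add: power_one_over)
      finally have "ennreal (\<phi> x / x) * indicator {0<..2 * pi} x \<le> ennreal (p m * 2 ^ Suc m) * indicator (D m) x"
        using m x by (simp add: D_def ennreal_leI)
      also have "\<dots> \<le> (\<Sum>m. ennreal (p m * 2 ^ Suc m) * indicator (D m) x)"
        using sum_le_suminf[OF summableI, of "{m}" "\<lambda>m. ennreal (p m * 2 ^ Suc m) * indicator (D m) x"]
        by (simp only: sum.insert finite.emptyI empty_iff sum.empty add_0_right simp_thms finite.insertI zero_le)
      finally show ?thesis by (rule add_increasing[rotated]) simp
    qed
  qed simp
  have "(\<integral>\<^sup>+ x \<in> {0<..2 * pi}. ennreal (\<phi> x / x) \<partial>lborel)
      \<le> (\<integral>\<^sup>+x. ennreal (\<phi> (2 * pi)) * indicator {1..2 * pi} x + (\<Sum>m. ennreal (p m * 2 ^ Suc m) * indicator (D m) x) \<partial>lborel)"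
    by (intro nn_integral_mono bound)
  also have "\<dots> = (\<integral>\<^sup>+x. ennreal (\<phi> (2 * pi)) * indicator {1..2 * pi} x \<partial>lborel)
      + (\<Sum>m. \<integral>\<^sup>+x. ennreal (p m * 2 ^ Suc m) * indicator (D m) x \<partial>lborel)"
    by (subst nn_integral_add, simp, simp add: D_def, subst nn_integral_suminf) (auto simp: D_def)
  also have "\<dots> = (\<integral>\<^sup>+x. ennreal (\<phi> (2 * pi)) * indicator {1..2 * pi} x \<partial>lborel) + (\<Sum>m. ennreal (p m))"
  proof -
    have "(\<integral>\<^sup>+x. ennreal (p m * 2 ^ Suc m) * indicator (D m) x \<partial>lborel) = ennreal (p m)" for m
    proof -
      have "emeasure lborel (D m) = ennreal ((1 / 2) ^ Suc m)" by (simp add: D_def)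
      hence "(\<integral>\<^sup>+x. ennreal (p m * 2 ^ Suc m) * indicator (D m) x \<partial>lborel) = ennreal (p m * 2 ^ Suc m) * ennreal ((1 / 2) ^ Suc m)"
        by (subst nn_integral_cmult_indicator) (auto simp: D_def)
      also have "\<dots> = ennreal (p m * 2 ^ Suc m * (1 / 2) ^ Suc m)" using p by (intro ennreal_mult[symmetric]) auto
      also have "p m * 2 ^ Suc m * (1 / 2) ^ Suc m = p m" by (simp add: power_one_over)
      finally show ?thesis .
    qed
    thus ?thesis by simp
  qed
  also have "\<dots> < \<infinity>"
  proof -
    have "(\<integral>\<^sup>+x. ennreal (\<phi> (2 * pi)) * indicator {1..2 * pi} x \<partial>lborel) < \<infinity>"
      by (subst nn_integral_cmult_indicator) (auto simp: ennreal_mult_less_top emeasure_lborel_Icc_eq)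
    thus ?thesis using fin by simp
  qed
  finally show False using div by simp
qed

section \<open>The mixture of Cantor stages\<close>

text \<open>
  The radius makes stage \<open>K\<close> invisible to the boxes of arcs of length at most \<open>2 ^ -K\<close>, at which scale the
  point masses would violate the box condition.
\<close>
definition cantor_point :: "nat \<Rightarrow> nat set \<Rightarrow> complex" where
  "cantor_point K S = of_real (1 - (1 / 2) ^ K) * cis (digit_angle S)"

lemma norm_cantor_point: "cmod (cantor_point K S) = 1 - (1 / 2) ^ K"
  by (simp only: cantor_point_def norm_mult norm_of_real norm_cis) (simp add: power_le_one)

lemma cantor_point_in_ball: "cantor_point K S \<in> ball 0 1"
  by (simp add: norm_cantor_point)

text \<open>
  Moving the points inwards costs at most a factor 4: the moments pick up the factor \<open>(1 - 2 ^ -K) ^ k\<close>,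
  and only frequencies \<open>k \<le> 2 ^ (K - 1)\<close> are used, for which it is at least \<open>1 / 2\<close> by Bernoulli's inequality.
\<close>
lemma cantor_energy_test_function:
  assumes B: "B > 0" and K: "64 * B + 1 \<le> (\<Sum>m\<in>{1..K}. 1 / 2 ^ card (A \<inter> {1..m}))"
  shows "\<exists>f\<in>dirichlet_space. \<exists>E\<ge>B. (dirichlet_norm f)\<^sup>2 \<le> E \<and>
           E\<^sup>2 \<le> (\<Sum>S\<in>Pow (A \<inter> {1..K}). (cmod (f (cantor_point K S)))\<^sup>2) / 2 ^ card (A \<inter> {1..K})"
proof -
  let ?D = "A \<inter> {1..K}" and ?r = "1 - (1 / 2 :: real) ^ K"
  have "K \<noteq> 0" using K B by (intro notI) simp
  define c where "c k = (\<Sum>S\<in>Pow ?D. cantor_point K S ^ k) / of_nat (card (Pow ?D))" for k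
  define E where "E = (\<Sum>k\<in>{1..2 ^ (K - 1)}. (cmod (c k))\<^sup>2 / real k)"
  have ck: "(cmod (c k))\<^sup>2 \<ge> riesz_product ?D k / 4" if k: "k \<le> 2 ^ (K - 1)" for k
  proof -
    have "c k = of_real (?r ^ k) * ((\<Sum>S\<in>Pow ?D. cis (digit_angle S) ^ k) / 2 ^ card ?D)"
      by (simp add: c_def cantor_point_def power_mult_distrib card_Pow sum_distrib_left del: Pow_Int_eq)
    hence "(cmod (c k))\<^sup>2 = (?r ^ k)\<^sup>2 * riesz_product ?D k"
      by (simp only: norm_mult power_mult_distrib norm_moment_digit_angle[of ?D k, simplified finite_Int finite_atLeastAtMost simp_thms] norm_of_real power2_abs)
    moreover have "1 / 4 \<le> (?r ^ k)\<^sup>2"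
    proof -
      have "real k \<le> real (2 ^ (K - 1))" using k by (rule of_nat_mono)
      hence "real k * (1 / 2) ^ K \<le> 2 ^ (K - 1) * (1 / 2) ^ K" by (intro mult_right_mono) auto
      also have "\<dots> = 1 / 2" using \<open>K \<noteq> 0\<close> by (cases K) (auto simp: power_one_over)
      finally have "1 / 2 \<le> 1 + real k * (- ((1 / 2) ^ K))" by simp
      also have "\<dots> \<le> (1 + (- ((1 / 2) ^ K))) ^ k"
        by (rule Bernoulli_inequality) (simp add: power_le_one)
      finally have "1 / 2 \<le> ?r ^ k" by simp
      hence "(1 / 2)\<^sup>2 \<le> (?r ^ k)\<^sup>2" by (intro power_mono) auto
      thus ?thesis by (simp add: power2_eq_square)
    qed
    ultimately show ?thesis
      using mult_right_mono[of "1 / 4" "(?r ^ k)\<^sup>2" "riesz_product ?D k"] riesz_product_nonneg[of ?D k] by simp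
  qed
  \<comment> \<open>the constant 64 is the factor 16 of \<open>riesz_energy_ge\<close> times the factor 4 lost to the radius\<close>
  have "B \<le> (((\<Sum>m\<in>{1..K}. 1 / 2 ^ card (A \<inter> {1..m})) - 1) / 16) / 4" using K by simp
  also have "\<dots> \<le> (\<Sum>k\<in>{1..2 ^ (K - 1)}. riesz_product ?D k / real k) / 4"
    by (intro divide_right_mono riesz_energy_ge) simp
  also have "\<dots> = (\<Sum>k\<in>{1..2 ^ (K - 1)}. riesz_product ?D k / 4 / real k)"
    unfolding sum_divide_distrib by (intro sum.cong refl) simp
  also have "\<dots> \<le> E"
    unfolding E_def by (intro sum_mono divide_right_mono ck) auto
  finally have "B \<le> E" .
  moreover have "\<exists>f\<in>dirichlet_space. (dirichlet_norm f)\<^sup>2 \<le> E \<and>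
      E\<^sup>2 \<le> (\<Sum>S\<in>Pow ?D. (cmod (f (cantor_point K S)))\<^sup>2) / real (card (Pow ?D))"
    unfolding E_def c_def by (rule energy_test_function) auto
  ultimately show ?thesis by (auto simp: card_Pow simp del: Pow_Int_eq)
qed

text \<open>
  The mixture is formed on pairs of a stage and a digit set, and only then pushed forward to the disk: a
  map into a restricted space has to take all its values there.
\<close>
definition cantor_mixture :: "nat set \<Rightarrow> (nat \<Rightarrow> nat) \<Rightarrow> complex measure" where
  "cantor_mixture A \<kappa> =
     distr (measure_pmf (bind_pmf (geometric_pmf (1 / 2))
              (\<lambda>n. map_pmf (Pair (\<kappa> n)) (pmf_of_set (Pow (A \<inter> {1..\<kappa> n}))))))
       (restrict_space borel (ball 0 1)) (\<lambda>(K, S). cantor_point K S)"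

lemma cantor_point_measurable:
  "(\<lambda>(K, S). cantor_point K S) \<in> measure_pmf q \<rightarrow>\<^sub>M restrict_space borel (ball 0 1)"
  using cantor_point_in_ball by (intro measurable_restrict_space2) auto

lemma finite_borel_measure_cantor_mixture: "finite_borel_measure_on_disk (cantor_mixture A \<kappa>)"
  unfolding finite_borel_measure_on_disk_def cantor_mixture_def
  by (auto intro!: finite_measure.finite_measure_distr cantor_point_measurable)

lemma nn_integral_cantor_mixture:
  assumes "g \<in> borel_measurable (restrict_space borel (ball 0 1))"
  shows "(\<integral>\<^sup>+z. g z \<partial>cantor_mixture A \<kappa>)
       = (\<integral>\<^sup>+n. (\<Sum>S\<in>Pow (A \<inter> {1..\<kappa> n}). g (cantor_point (\<kappa> n) S)) / 2 ^ card (A \<inter> {1..\<kappa> n})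
            \<partial>measure_pmf (geometric_pmf (1 / 2)))"
proof -
  have uniform: "(\<integral>\<^sup>+S. h S \<partial>measure_pmf (pmf_of_set (Pow (A \<inter> {1..K})))) = sum h (Pow (A \<inter> {1..K})) / 2 ^ card (A \<inter> {1..K})"
    for h :: "nat set \<Rightarrow> ennreal" and K
    by (subst nn_integral_pmf_of_set) (auto simp: card_Pow simp del: Pow_Int_eq)
  show ?thesis
    unfolding cantor_mixture_def
    by (subst nn_integral_distr, rule cantor_point_measurable) (use assms uniform in \<open>simp_all del: Pow_Int_eq One_nat_def\<close>)
qed

lemma measure_cantor_mixture_le:
  assumes c: "c \<ge> 0"
    and le: "\<And>K. real (card {S \<in> Pow (A \<inter> {1..K}). cantor_point K S \<in> X}) \<le> c * 2 ^ card (A \<inter> {1..K})"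
  shows "measure (cantor_mixture A \<kappa>) X \<le> c"
proof (cases "X \<in> sets (restrict_space borel (ball 0 1))")
  case True
  have "emeasure (cantor_mixture A \<kappa>) X = (\<integral>\<^sup>+z. indicator X z \<partial>cantor_mixture A \<kappa>)"
    using True by (simp add: cantor_mixture_def)
  also have "\<dots> = (\<integral>\<^sup>+n. (\<Sum>S\<in>Pow (A \<inter> {1..\<kappa> n}). indicator X (cantor_point (\<kappa> n) S)) / 2 ^ card (A \<inter> {1..\<kappa> n})
      \<partial>measure_pmf (geometric_pmf (1 / 2)))"
    using True by (intro nn_integral_cantor_mixture) simp
  also have "\<dots> \<le> (\<integral>\<^sup>+n. ennreal c \<partial>measure_pmf (geometric_pmf (1 / 2)))"
  proof (intro nn_integral_mono)
    fix n
    let ?D = "A \<inter> {1..\<kappa> n}"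
    have "(\<Sum>S\<in>Pow ?D. indicator X (cantor_point (\<kappa> n) S) :: ennreal)
        = ennreal (real (card {S \<in> Pow ?D. cantor_point (\<kappa> n) S \<in> X}))"
      by (simp add: indicator_def sum.If_cases Int_def ennreal_of_nat_eq_real_of_nat del: Pow_Int_eq)
    hence "(\<Sum>S\<in>Pow ?D. indicator X (cantor_point (\<kappa> n) S)) / 2 ^ card ?D
        = ennreal (real (card {S \<in> Pow ?D. cantor_point (\<kappa> n) S \<in> X})) / ennreal (2 ^ card ?D)"
      by (simp add: ennreal_power[symmetric])
    also have "\<dots> = ennreal (real (card {S \<in> Pow ?D. cantor_point (\<kappa> n) S \<in> X}) / 2 ^ card ?D)"
      by (rule divide_ennreal) auto
    also have "\<dots> \<le> ennreal c"
      using le[of "\<kappa> n"] by (intro ennreal_leI) (simp add: field_simps)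
    finally show "(\<Sum>S\<in>Pow ?D. indicator X (cantor_point (\<kappa> n) S)) / 2 ^ card ?D \<le> ennreal c" .
  qed
  also have "\<dots> = ennreal c" by simp
  finally show ?thesis using c by (simp add: measure_def enn2real_leI)
next
  case False
  thus ?thesis using c by (simp add: measure_notin_sets cantor_mixture_def)
qed

lemma nn_integral_cantor_mixture_ge:
  assumes f: "f holomorphic_on ball 0 1"
    and avg: "a \<le> (\<Sum>S\<in>Pow (A \<inter> {1..\<kappa> n}). (cmod (f (cantor_point (\<kappa> n) S)))\<^sup>2) / 2 ^ card (A \<inter> {1..\<kappa> n})"
  shows "ennreal ((1 / 2) ^ Suc n * a) \<le> (\<integral>\<^sup>+z. ennreal ((cmod (f z))\<^sup>2) \<partial>cantor_mixture A \<kappa>)"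
proof -
  define h where "h n = (\<Sum>S\<in>Pow (A \<inter> {1..\<kappa> n}). ennreal ((cmod (f (cantor_point (\<kappa> n) S)))\<^sup>2)) / 2 ^ card (A \<inter> {1..\<kappa> n})" for n
  have "f \<in> borel_measurable (restrict_space borel (ball 0 1))"
    using f by (intro borel_measurable_continuous_on_restrict holomorphic_on_imp_continuous_on)
  hence eq: "(\<integral>\<^sup>+z. ennreal ((cmod (f z))\<^sup>2) \<partial>cantor_mixture A \<kappa>) = (\<integral>\<^sup>+n. h n \<partial>measure_pmf (geometric_pmf (1 / 2)))"
    unfolding h_def by (intro nn_integral_cantor_mixture) simp
  have "ennreal a \<le> h n"
  proof -
    have "h n = ennreal (\<Sum>S\<in>Pow (A \<inter> {1..\<kappa> n}). (cmod (f (cantor_point (\<kappa> n) S)))\<^sup>2) / ennreal (2 ^ card (A \<inter> {1..\<kappa> n}))"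
      unfolding h_def by (subst sum_ennreal) (simp_all add: ennreal_power[symmetric] del: Pow_Int_eq)
    also have "\<dots> = ennreal ((\<Sum>S\<in>Pow (A \<inter> {1..\<kappa> n}). (cmod (f (cantor_point (\<kappa> n) S)))\<^sup>2) / 2 ^ card (A \<inter> {1..\<kappa> n}))"
      by (intro divide_ennreal sum_nonneg) auto
    finally show ?thesis using avg by (simp add: ennreal_leI)
  qed
  have "ennreal ((1 / 2) ^ Suc n * a) = ennreal (pmf (geometric_pmf (1 / 2)) n) * ennreal a"
    by (subst ennreal_mult'[symmetric]) (auto simp: pmf_geometric)
  also have "\<dots> \<le> h n * ennreal (pmf (geometric_pmf (1 / 2)) n)"
    using \<open>ennreal a \<le> h n\<close> by (subst mult.commute) (intro mult_right_mono, auto)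
  also have "\<dots> = (\<integral>\<^sup>+k. h n * indicator {n} k \<partial>measure_pmf (geometric_pmf (1 / 2)))"
    by (subst nn_integral_cmult_indicator) (auto simp: emeasure_pmf_single)
  also have "\<dots> \<le> (\<integral>\<^sup>+k. h k \<partial>measure_pmf (geometric_pmf (1 / 2)))"
    by (intro nn_integral_mono) (auto split: split_indicator)
  finally show ?thesis unfolding eq .
qed

text \<open>
  For an arc of length \<open>l\<close> between \<open>2 ^ -(m + 1)\<close> and \<open>2 ^ -m\<close>, a stage that meets the box has \<open>K \<ge> m\<close>.
  Its mass in the box is then at most \<open>12 * 2 ^ -N m\<close>, which is controlled by \<open>\<phi> (2 ^ -m) \<le> 2 * \<phi> l\<close>.
\<close>
lemma cantor_mixture_one_box:
  fixes \<phi> :: "real \<Rightarrow> real"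
  assumes pos: "\<And>x. x \<in> {0<..2 * pi} \<Longrightarrow> \<phi> x > 0"
    and mono: "mono_on {0<..2 * pi} \<phi>"
    and anti: "strict_antimono_on {0<..2 * pi} (\<lambda>x. \<phi> x / x)"
    and A: "\<And>m. 1 / 2 ^ card (A \<inter> {1..m}) \<le> 2 * \<phi> ((1 / 2) ^ m) / \<phi> 1"
  shows "one_box_condition (cantor_mixture A \<kappa>) \<phi>"
proof -
  have "(1::real) \<in> {0<..2 * pi}" using pi_gt3 by auto
  note \<phi>1 = pos[OF this]
  have box_le: "measure (cantor_mixture A \<kappa>) (carleson_box I) \<le> 48 / \<phi> 1 * \<phi> (arclength I)"
    if I: "circle_arc I \<and> 0 < arclength I \<and> arclength I < 1" for I
  proof -
    let ?l = "arclength I"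
    have l: "?l \<in> {0<..2 * pi}" using I pi_gt3 by auto
    obtain m where m: "(1 / 2) ^ Suc m < ?l" "?l \<le> (1 / 2) ^ m" using dyadic_scale[of ?l] I by auto
    have "\<phi> ((1 / 2) ^ m) \<le> 2 * \<phi> ((1 / 2) ^ Suc m)" using gauge_doubling[OF anti, of m] by simp
    also have "\<phi> ((1 / 2) ^ Suc m) \<le> \<phi> ?l"
      using m by (intro mono_onD[OF mono dyadic_in_gauge_domain l]) simp
    finally have "2 * \<phi> ((1 / 2) ^ m) / \<phi> 1 \<le> 2 * (2 * \<phi> ?l) / \<phi> 1" using \<phi>1 by (intro divide_right_mono) auto
    with A[of m] have Am: "1 / 2 ^ card (A \<inter> {1..m}) \<le> 4 * \<phi> ?l / \<phi> 1" by simp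
    show ?thesis
    proof (rule measure_cantor_mixture_le)
      show "0 \<le> 48 / \<phi> 1 * \<phi> ?l" using \<phi>1 pos[OF l] by simp
      fix K
      let ?Y = "{S \<in> Pow (A \<inter> {1..K}). cantor_point K S \<in> carleson_box I}"
      have box: "(1 / 2) ^ K < ?l \<and> cis (digit_angle S) \<in> I" if S: "cantor_point K S \<in> carleson_box I" for S
      proof -
        obtain r \<theta> where r: "cantor_point K S = of_real r * cis \<theta>" "1 - ?l < r" "r < 1" "cis \<theta> \<in> I"
          using S unfolding carleson_box_def by blast
        have "r > 0" using r(2) I by linarith
        have "cmod (cantor_point K S) = r" using \<open>r > 0\<close> by (simp add: r(1) norm_mult)
        hence rK: "r = 1 - (1 / 2) ^ K" by (simp add: norm_cantor_point)
        hence "cis (digit_angle S) = cis \<theta>"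
          using r(1) \<open>r > 0\<close> unfolding cantor_point_def rK[symmetric] by simp
        thus ?thesis using r rK by auto
      qed
      show "real (card ?Y) \<le> 48 / \<phi> 1 * \<phi> ?l * 2 ^ card (A \<inter> {1..K})"
      proof (cases "(1 / 2) ^ K < ?l")
        case False
        hence "?Y = {}" using box by blast
        hence Y: "real (card ?Y) = 0" by (simp only: card.empty of_nat_0)
        show ?thesis unfolding Y using \<phi>1 pos[OF l] by simp
      next
        case True
        have "m \<le> K"
        proof (rule ccontr)
          assume "\<not> m \<le> K"
          hence "(1 / 2 :: real) ^ m \<le> (1 / 2) ^ K" by (intro power_decreasing) auto
          thus False using True m(2) by linarith
        qed
        have "card ?Y \<le> card {S \<in> Pow (A \<inter> {1..K}). cis (digit_angle S) \<in> I}"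
          using box by (intro card_mono) auto
        hence "real (card ?Y) \<le> real (card {S \<in> Pow (A \<inter> {1..K}). cis (digit_angle S) \<in> I})"
          by (rule of_nat_mono)
        also have "\<dots> \<le> 12 * 2 ^ card (A \<inter> {1..K}) / 2 ^ card (A \<inter> {1..m})"
          using I m(2) \<open>m \<le> K\<close> by (intro card_digits_in_arc_le) auto
        also have "\<dots> = 12 * 2 ^ card (A \<inter> {1..K}) * (1 / 2 ^ card (A \<inter> {1..m}))" by simp
        also have "\<dots> \<le> 12 * 2 ^ card (A \<inter> {1..K}) * (4 * \<phi> ?l / \<phi> 1)"
          by (intro mult_left_mono Am) auto
        finally show ?thesis by (simp add: mult_ac)
      qed
    qed
  qed
  show ?thesis
    unfolding one_box_condition_def
    by (rule exI[of _ "48 / \<phi> 1"], rule conjI, use \<phi>1 in simp, rule exI[of _ 1]) (use box_le in simp)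
qed

text \<open>
  If \<open>C\<close> were a Carleson constant, the test function of stage \<open>\<kappa> n\<close> with energy \<open>E\<close> would give
  \<open>2 ^ -(n + 1) * E\<^sup>2 \<le> C * E\<close>. Choosing \<open>\<kappa> n\<close> with \<open>E \<ge> 4 ^ n\<close> makes this fail for large \<open>n\<close>.
\<close>
lemma cantor_mixture_not_carleson:
  assumes "\<And>B :: real. \<exists>K. B \<le> (\<Sum>m\<in>{1..K}. 1 / 2 ^ card (A \<inter> {1..m}))"
  obtains \<kappa> where "\<not> dirichlet_carleson_measure (cantor_mixture A \<kappa>)"
proof -
  \<comment> \<open>the threshold that \<open>cantor_energy_test_function\<close> requires for energy \<open>4 ^ n\<close>\<close>
  have "\<forall>n. \<exists>K. 64 * 4 ^ n + 1 \<le> (\<Sum>m\<in>{1..K}. 1 / (2 :: real) ^ card (A \<inter> {1..m}))"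
    using assms by blast
  then obtain \<kappa> where \<kappa>: "\<And>n. 64 * 4 ^ n + 1 \<le> (\<Sum>m\<in>{1..\<kappa> n}. 1 / (2 :: real) ^ card (A \<inter> {1..m}))"
    by metis
  have "\<not> dirichlet_carleson_measure (cantor_mixture A \<kappa>)"
  proof
    assume "dirichlet_carleson_measure (cantor_mixture A \<kappa>)"
    then obtain C where C: "C \<ge> 0" "\<And>f. f \<in> dirichlet_space \<Longrightarrow>
        (\<integral>\<^sup>+z. ennreal ((cmod (f z))\<^sup>2) \<partial>cantor_mixture A \<kappa>) \<le> ennreal (C * (dirichlet_norm f)\<^sup>2)"
      by (auto simp: dirichlet_carleson_measure_def)
    have "2 ^ n \<le> 2 * C" for n
    proof -
      obtain f E where f: "f \<in> dirichlet_space" "4 ^ n \<le> E" "(dirichlet_norm f)\<^sup>2 \<le> E"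
        "E\<^sup>2 \<le> (\<Sum>S\<in>Pow (A \<inter> {1..\<kappa> n}). (cmod (f (cantor_point (\<kappa> n) S)))\<^sup>2) / 2 ^ card (A \<inter> {1..\<kappa> n})"
        using cantor_energy_test_function[OF _ \<kappa>[of n]] by auto
      have E: "E > 0" using f(2) by (rule less_le_trans[rotated]) simp
      have "f holomorphic_on ball 0 1" using f(1) by (simp add: dirichlet_space_def)
      hence "ennreal ((1 / 2) ^ Suc n * E\<^sup>2) \<le> (\<integral>\<^sup>+z. ennreal ((cmod (f z))\<^sup>2) \<partial>cantor_mixture A \<kappa>)"
        using f(4) by (rule nn_integral_cantor_mixture_ge)
      hence "ennreal ((1 / 2) ^ Suc n * E\<^sup>2) \<le> ennreal (C * (dirichlet_norm f)\<^sup>2)"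
        using C(2)[OF f(1)] by (rule order.trans)
      hence "(1 / 2) ^ Suc n * E\<^sup>2 \<le> C * (dirichlet_norm f)\<^sup>2"
        using C(1) by (subst (asm) ennreal_le_iff) auto
      also have "\<dots> \<le> C * E" using f(3) C(1) by (rule mult_left_mono)
      finally have "(1 / 2) ^ Suc n * E * E \<le> C * E" by (simp add: power2_eq_square mult_ac)
      hence le: "(1 / 2) ^ Suc n * E \<le> C" using E by simp
      have "2 ^ n / 2 = (1 / 2 :: real) ^ Suc n * 4 ^ n"
        by (simp flip: power_mult_distrib)
      also have "\<dots> \<le> (1 / 2) ^ Suc n * E" using f(2) by (intro mult_left_mono) auto
      also note le
      finally show ?thesis by simp
    qed
    moreover obtain n where "2 * C < 2 ^ n" using real_arch_pow[of 2 "2 * C"] by auto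
    ultimately show False by (meson not_le)
  qed
  thus ?thesis using that by blast
qed

theorem theorem1p2:
  fixes \<phi> :: "real \<Rightarrow> real"
  assumes "\<And>x. x \<in> {0<..2 * pi} \<Longrightarrow> \<phi> x > 0"
    and "continuous_on {0<..2 * pi} \<phi>"
    and "mono_on {0<..2 * pi} \<phi>"
    and "strict_antimono_on {0<..2 * pi} (\<lambda>x. \<phi> x / x)"
    and "(\<integral>\<^sup>+ x \<in> {0<..2 * pi}. ennreal (\<phi> x / x) \<partial>lborel) = \<infinity>"
  shows "\<exists>\<mu> :: complex measure. finite_borel_measure_on_disk \<mu> \<and>
           one_box_condition \<mu> \<phi> \<and> \<not> dirichlet_carleson_measure \<mu>"
proof -
  have \<phi>1: "\<phi> 1 > 0" using assms(1)[of 1] pi_gt3 by auto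
  obtain A where A: "\<And>m. \<phi> ((1 / 2) ^ m) / \<phi> 1 \<le> 1 / 2 ^ card (A \<inter> {1..m})"
    "\<And>m. 1 / 2 ^ card (A \<inter> {1..m}) \<le> 2 * \<phi> ((1 / 2) ^ m) / \<phi> 1"
    using gauge_digits[OF assms(1,3,4)] by blast
  have "\<exists>K. B \<le> (\<Sum>m\<in>{1..K}. 1 / 2 ^ card (A \<inter> {1..m}))" for B :: real
  proof -
    obtain K where "B * \<phi> 1 \<le> (\<Sum>m\<in>{1..K}. \<phi> ((1 / 2) ^ m))"
      using gauge_dyadic_sums_unbounded[OF assms(1,3,5)] by blast
    hence "B \<le> (\<Sum>m\<in>{1..K}. \<phi> ((1 / 2) ^ m) / \<phi> 1)"
      using \<phi>1 by (simp add: pos_le_divide_eq flip: sum_divide_distrib)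
    also have "\<dots> \<le> (\<Sum>m\<in>{1..K}. 1 / 2 ^ card (A \<inter> {1..m}))"
      by (intro sum_mono A)
    finally show ?thesis by blast
  qed
  then obtain \<kappa> where "\<not> dirichlet_carleson_measure (cantor_mixture A \<kappa>)"
    using cantor_mixture_not_carleson by blast
  moreover have "one_box_condition (cantor_mixture A \<kappa>) \<phi>"
    using assms(1,3,4) A(2) by (rule cantor_mixture_one_box)
  ultimately show ?thesis using finite_borel_measure_cantor_mixture by blast
qed

end
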